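(* A complete list of discrete point symmetry transformations of the linear (1+1)-dimensional heat equation $u_t=u_{xx}$ that are independent up to composing with each other and with continuous point symmetry transformations of this equation is exhausted by the single involution $\mathscr I'\colon (t,x,u)\mapsto(t,x,-u)$ alternating the sign of $u$. Thus, the factor group of the point symmetry pseudogroup $G$ of this equation with respect to its identity component $G_{\rm id}$ is isomorphic to $\mathbb Z_2$.
   Context: The point symmetry pseudogroup $G$ of the heat equation consists of the transformations $\Phi[\alpha,\beta,\gamma,\delta,\lambda_1,\lambda_0,\sigma,h]$ given by $$\tilde t=\frac{\alpha t+\beta}{\gamma t+\delta},\quad \tilde x=\frac{x+\lambda_1t+\lambda_0}{\gamma t+\delta},\quad \tilde u=\sigma\sqrt{|\gamma t+\delta|}\,\exp\!\left(\frac{\gamma (x+\lambda_1t+\lambda_0)^2}{4(\gamma t+\delta)}-\frac{\lambda_1}2x-\frac{\lambda_1^2}4t\right)\big(u+h(t,x)\big),$$ where $\alpha,\beta,\gamma,\delta,\lambda_1,\lambda_0,\sigma\in\mathbb R$, $\alpha\delta-\beta\gamma=1$, $\sigma\ne0$, and $h$ is an arbitrary (locally defined smooth) solution of the heat equation. Each such transformation is considered on its natural domain $(\operatorname{dom}h\times\mathbb R_u)\setminus\{\gamma t+\delta=0\}$. The multiplication in $G$ is the modified composition $\Phi_1\circ^{\rm m}\Phi_2$: it is the transformation $\Phi[\alpha,\beta,\gamma,\delta,\lambda_1,\lambda_0,\sigma,h]$ that has the same parameters $(\alpha,\beta,\gamma,\delta,\lambda_1,\lambda_0,\sigma,h)$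 as the usual composition $\Phi_1\circ\Phi_2$ and is considered on its natural domain $(\operatorname{dom}h\times\mathbb R_u)\setminus\{\gamma t+\delta=0\}$, i.e., the continuous extension of $\Phi_1\circ\Phi_2$ to that domain. The identity component $G_{\rm id}$ consists of the elements that can be connected with the identity transformation by a continuous path in $G$ (i.e., a continuous path in the parameters $(\alpha,\beta,\gamma,\delta,\lambda_1,\lambda_0,\sigma,h)$). Elements of $G_{\rm id}$ are the continuous point symmetry transformations, and elements of $G\setminus G_{\rm id}$ are the discrete ones. *)

theory Defs
  imports "HOL-Analysis.Analysis" "HOL-Algebra.Elementary_Groups"
begin

text \<open>\<open>C_on k f D\<close>: the function \<open>f\<close> of \<open>(t, x)\<close> is of class \<open>C\<^sup>k\<close> on the open set \<open>D\<close>.\<close>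

primrec C_on :: "nat \<Rightarrow> (real \<times> real \<Rightarrow> real) \<Rightarrow> (real \<times> real) set \<Rightarrow> bool" where
  "C_on 0 f D \<longleftrightarrow> continuous_on D f"
| "C_on (Suc k) f D \<longleftrightarrow>
     (\<exists>ft fx. (\<forall>z\<in>D. (f has_derivative (\<lambda>(a, b). ft z * a + fx z * b)) (at z)) \<and>
              C_on k ft D \<and> C_on k fx D)"

text \<open>A locally defined function is a partial map; its domain is required to be open and
  nonempty, so that the empty transformation does not occur below.\<close>

definition local_solution :: "(real \<times> real \<rightharpoonup> real) \<Rightarrow> bool" where
  "local_solution h \<longleftrightarrow>
     open (dom h) \<and> dom h \<noteq> {} \<and> (\<forall>k. C_on k (the \<circ> h) (dom h)) \<and>
     (\<forall>(t, x)\<in>dom h. deriv (\<lambda>s. the (h (s, x))) t = (deriv ^^ 2) (\<lambda>y. the (h (t, y))) x)"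

type_synonym coeffs = "real \<times> real \<times> real \<times> real \<times> real \<times> real \<times> real"

text \<open>Points \<open>(t, x, u)\<close>; transformations are partial maps between such points.\<close>

type_synonym transformation = "real \<times> real \<times> real \<rightharpoonup> real \<times> real \<times> real"

definition coeffs_space :: "coeffs set" where
  "coeffs_space = {(\<alpha>, \<beta>, \<gamma>, \<delta>, l\<^sub>1, l\<^sub>0, \<sigma>). \<alpha> * \<delta> - \<beta> * \<gamma> = 1 \<and> \<sigma> \<noteq> 0}"

definition Phi :: "coeffs \<Rightarrow> (real \<times> real \<rightharpoonup> real) \<Rightarrow> transformation" where
  "Phi = (\<lambda>(\<alpha>, \<beta>, \<gamma>, \<delta>, l\<^sub>1, l\<^sub>0, \<sigma>) h (t, x, u).
     if (t, x) \<in> dom h \<and> \<gamma> * t + \<delta> \<noteq> 0 then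
       Some ((\<alpha> * t + \<beta>) / (\<gamma> * t + \<delta>),
             (x + l\<^sub>1 * t + l\<^sub>0) / (\<gamma> * t + \<delta>),
             \<sigma> * sqrt \<bar>\<gamma> * t + \<delta>\<bar> *
               exp (\<gamma> * (x + l\<^sub>1 * t + l\<^sub>0)^2 / (4 * (\<gamma> * t + \<delta>)) - l\<^sub>1 / 2 * x - l\<^sub>1^2 / 4 * t) *
               (u + the (h (t, x))))
     else None)"

definition heat_G :: "transformation set" where
  "heat_G = {Phi c h | c h. c \<in> coeffs_space \<and> local_solution h}"

text \<open>\<open>\<Phi>\<^sub>1 \<circ>\<^sub>m \<Phi>\<^sub>2\<close> is the library's usual composition of partial maps. It is undefined on the
  singular line of \<open>\<Phi>\<^sub>2\<close> even where its parameter function \<open>h\<close> extends to that line. The modified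
  composition is the largest element of the pseudogroup that extends \<open>\<Phi>\<^sub>1 \<circ>\<^sub>m \<Phi>\<^sub>2\<close> and adds only
  points of that line. All elements of the pseudogroup are continuous, so the values at the
  added points are limits of values of \<open>\<Phi>\<^sub>1 \<circ>\<^sub>m \<Phi>\<^sub>2\<close>.\<close>

definition composable :: "transformation \<Rightarrow> transformation \<Rightarrow> bool" where
  "composable \<Phi>\<^sub>1 \<Phi>\<^sub>2 \<longleftrightarrow> dom (\<Phi>\<^sub>1 \<circ>\<^sub>m \<Phi>\<^sub>2) \<noteq> {}"

definition singular_times :: "transformation \<Rightarrow> real set" where
  "singular_times \<Phi> =
     {t. \<exists>\<alpha> \<beta> \<gamma> \<delta> l\<^sub>1 l\<^sub>0 \<sigma> h. (\<alpha>, \<beta>, \<gamma>, \<delta>, l\<^sub>1, l\<^sub>0, \<sigma>) \<in> coeffs_space \<and> local_solution h \<and>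
         \<Phi> = Phi (\<alpha>, \<beta>, \<gamma>, \<delta>, l\<^sub>1, l\<^sub>0, \<sigma>) h \<and> \<gamma> * t + \<delta> = 0}"

definition comp_extensions :: "transformation \<Rightarrow> transformation \<Rightarrow> transformation set" where
  "comp_extensions \<Phi>\<^sub>1 \<Phi>\<^sub>2 =
     {\<Phi> \<in> heat_G. \<Phi>\<^sub>1 \<circ>\<^sub>m \<Phi>\<^sub>2 \<subseteq>\<^sub>m \<Phi> \<and>
        (\<forall>(t, x, u) \<in> dom \<Phi> - dom (\<Phi>\<^sub>1 \<circ>\<^sub>m \<Phi>\<^sub>2). t \<in> singular_times \<Phi>\<^sub>2)}"

text \<open>Meaningful for composable elements of \<^const>\<open>heat_G\<close> only.\<close>

definition mcomp :: "transformation \<Rightarrow> transformation \<Rightarrow> transformation" where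
  "mcomp \<Phi>\<^sub>1 \<Phi>\<^sub>2 =
     (THE \<Phi>. \<Phi> \<in> comp_extensions \<Phi>\<^sub>1 \<Phi>\<^sub>2 \<and> (\<forall>\<Psi> \<in> comp_extensions \<Phi>\<^sub>1 \<Phi>\<^sub>2. \<Psi> \<subseteq>\<^sub>m \<Phi>))"

text \<open>Continuity in the parameter \<open>h\<close> is with respect to the compact-open topology on partial
  maps with open domains: a path \<open>s \<mapsto> H s\<close> is continuous if the set of all \<open>(s, z)\<close> with \<open>z\<close> in
  the domain of \<open>H s\<close> is relatively open and \<open>(s, z) \<mapsto> H s z\<close> is continuous there.
  The domain may thus vary along the path.\<close>

definition solution_path :: "(real \<Rightarrow> real \<times> real \<rightharpoonup> real) \<Rightarrow> bool" where
  "solution_path H \<longleftrightarrow>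
     (\<forall>s\<in>{0..1}. local_solution (H s)) \<and>
     openin (top_of_set ({0..1} \<times> UNIV)) (SIGMA s:{0..1}. dom (H s)) \<and>
     continuous_on (SIGMA s:{0..1}. dom (H s)) (\<lambda>(s, z). the (H s z))"

text \<open>The identity transformation is \<^const>\<open>Some\<close>.\<close>

definition heat_G_id :: "transformation set" where
  "heat_G_id =
     {\<Phi>. \<exists>c H. path c \<and> path_image c \<subseteq> coeffs_space \<and> solution_path H \<and>
           Phi (pathstart c) (H 0) = Some \<and> Phi (pathfinish c) (H 1) = \<Phi>}"

inductive_set composites :: "transformation set \<Rightarrow> transformation set" for S where
  base: "\<Phi> \<in> S \<Longrightarrow> \<Phi> \<in> composites S"
| comp: "\<Phi> \<in> composites S \<Longrightarrow> \<Psi> \<in> composites S \<Longrightarrow> composable \<Phi> \<Psi> \<Longrightarrow>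
         mcomp \<Phi> \<Psi> \<in> composites S"

definition complete_discrete_list :: "transformation set \<Rightarrow> bool" where
  "complete_discrete_list S \<longleftrightarrow>
     S \<subseteq> heat_G - heat_G_id \<and> heat_G - heat_G_id \<subseteq> composites (S \<union> heat_G_id)"

definition independent_discrete_list :: "transformation set \<Rightarrow> bool" where
  "independent_discrete_list S \<longleftrightarrow>
     S \<subseteq> heat_G - heat_G_id \<and> (\<forall>\<Phi>\<in>S. \<Phi> \<notin> composites ((S - {\<Phi>}) \<union> heat_G_id))"

definition sign_change :: transformation where
  "sign_change = (\<lambda>(t, x, u). Some (t, x, - u))"

text \<open>Composition in a pseudogroup cuts down domains, so the sets \<open>{mcomp \<Theta> \<Phi> | \<Theta> \<in> H}\<close> overlap
  without being equal. The cosets are therefore taken to be the classes of the equivalence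
  relation generated by composition with elements of \<open>H\<close>; in a group these are exactly the
  cosets of the subgroup \<open>H\<close>.\<close>

definition left_congruence :: "transformation set \<Rightarrow> transformation rel" where
  "left_congruence H =
     {(\<Phi>, \<Psi>). equivclp (\<lambda>\<Phi> \<Psi>. \<Phi> \<in> heat_G \<and> (\<exists>\<Theta>\<in>H. composable \<Theta> \<Phi> \<and> \<Psi> = mcomp \<Theta> \<Phi>)) \<Phi> \<Psi>}"

definition right_congruence :: "transformation set \<Rightarrow> transformation rel" where
  "right_congruence H =
     {(\<Phi>, \<Psi>). equivclp (\<lambda>\<Phi> \<Psi>. \<Phi> \<in> heat_G \<and> (\<exists>\<Theta>\<in>H. composable \<Phi> \<Theta> \<and> \<Psi> = mcomp \<Phi> \<Theta>)) \<Phi> \<Psi>}"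

text \<open>As in \<^const>\<open>FactGroup\<close>, classes are multiplied elementwise.\<close>

definition heat_factor :: "transformation set \<Rightarrow> transformation set monoid" where
  "heat_factor H =
     \<lparr>carrier = heat_G // left_congruence H,
      mult = (\<lambda>A B. {mcomp \<Phi> \<Psi> | \<Phi> \<Psi>. \<Phi> \<in> A \<and> \<Psi> \<in> B \<and> composable \<Phi> \<Psi>}),
      one = H\<rparr>"

end

theory Submission imports Defs begin

text \<open>The coefficients of an element of the pseudogroup are determined by the transformation, so the
  sign of \<open>\<sigma>\<close> is well defined, and it is multiplicative under the modified composition. A path in
  the parameters cannot cross \<open>\<sigma> = 0\<close>; conversely, \<open>SL(2, \<real>)\<close> is path connected and every local
  solution can be joined to the zero solution on the plane, so the identity component consists of
  the elements with \<open>\<sigma> > 0\<close>. Composing with suitable elements of the identity component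
  takes every element first to one of the form \<open>(t, x, u) \<mapsto> (t, x, r (u + h))\<close>, then to a restriction
  of \<open>(t, x, u) \<mapsto> (t, x, \<plusminus>u)\<close>, which is in turn related to its extension to the whole space. Hence
  there are exactly two classes, given by the sign of \<open>\<sigma>\<close>.\<close>

section \<open>Smooth solutions of the heat equation\<close>

text \<open>Everything rests on the shape of \<open>Phi c h\<close>: it is affine in u, with slope
  \<open>amp c\<close>, over the map \<open>proj c\<close> of the (t, x) plane; \<open>proj\<close>
  composes and \<open>amp\<close> is a multiplicative cocycle over it. A composition therefore has
  the parameter function h2 + (h1 o proj c2) / amp c2, and closure of the pseudogroup means that
  pulling back along \<open>proj c2\<close> and dividing by \<open>amp c2\<close> preserves
  solutions. The obstacle is \<open>mcomp\<close>: a composition loses the singular line of its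
  second factor, which the largest extension may refill, so a largest extension must be constructed
  before any product is known. Sign arguments see only its coefficients. Its parameter function is
  computed only for products in which nothing can be refilled, namely when one factor is a scaling
  of u on the appropriate side. Coefficients are unique because the x-component detects the sign of
  the matrix in SL(2). The matrix -1 with zero shifts acts as x -> -x, which is thus a continuous
  symmetry and not a second discrete one.\<close>

definition has_grad :: "(real \<times> real \<Rightarrow> real) \<Rightarrow> real \<Rightarrow> real \<Rightarrow> real \<times> real \<Rightarrow> bool" where
  "has_grad f p q z \<longleftrightarrow> (f has_derivative (\<lambda>(a, b). p * a + q * b)) (at z)"

text \<open>The closure rules below yield partial derivatives in a fixed shape; applied through this
  rule, they leave exactly the two identities with the intended shape to prove.\<close>

lemma has_grad_eq: "has_grad f p q z \<Longrightarrow> p = p' \<Longrightarrow> q = q' \<Longrightarrow> has_grad f p' q' z"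
  by simp

lemma has_grad_unique:
  assumes "has_grad f p q z" "has_grad f p' q' z"
  shows "p = p' \<and> q = q'"
proof -
  have "(\<lambda>(a, b). p * a + q * b) = (\<lambda>(a, b). p' * a + q' * b)"
    using has_derivative_unique assms unfolding has_grad_def by blast
  from fun_cong[OF this, of "(1, 0)"] fun_cong[OF this, of "(0, 1)"] show ?thesis by simp
qed

lemma has_grad_cong:
  assumes "has_grad f p q z" "open D" "z \<in> D" "\<And>w. w \<in> D \<Longrightarrow> f w = g w"
  shows "has_grad g p q z"
  using has_derivative_transform_within_open assms unfolding has_grad_def by blast

lemma has_grad_const: "has_grad (\<lambda>z. c) 0 0 z"
  by (auto intro!: derivative_eq_intros simp: case_prod_beta has_grad_def)

lemma has_grad_fst: "has_grad fst 1 0 z"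
  by (auto intro!: derivative_eq_intros simp: case_prod_beta has_grad_def)

lemma has_grad_snd: "has_grad snd 0 1 z"
  by (auto intro!: derivative_eq_intros simp: case_prod_beta has_grad_def)

lemma has_grad_add:
  "has_grad f p q z \<Longrightarrow> has_grad g p' q' z \<Longrightarrow> has_grad (\<lambda>z. f z + g z) (p + p') (q + q') z"
  unfolding has_grad_def by (erule (1) has_derivative_eq_rhs[OF has_derivative_add])
    (auto simp: algebra_simps)

lemma has_grad_mult:
  "has_grad f p q z \<Longrightarrow> has_grad g p' q' z \<Longrightarrow>
     has_grad (\<lambda>z. f z * g z) (p * g z + f z * p') (q * g z + f z * q') z"
  unfolding has_grad_def by (erule (1) has_derivative_eq_rhs[OF has_derivative_mult])
    (auto simp: algebra_simps)

lemma has_grad_chain: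
  assumes "has_grad f p q (g z, h z)" "has_grad g p1 q1 z" "has_grad h p2 q2 z"
  shows "has_grad (\<lambda>z. f (g z, h z)) (p * p1 + q * p2) (p * q1 + q * q2) z"
proof -
  have "((\<lambda>z. (g z, h z)) has_derivative
      (\<lambda>w. ((\<lambda>(a, b). p1 * a + q1 * b) w, (\<lambda>(a, b). p2 * a + q2 * b) w))) (at z)"
    by (intro has_derivative_Pair assms[unfolded has_grad_def])
  from diff_chain_at[OF this assms(1)[unfolded has_grad_def]] show ?thesis
    unfolding has_grad_def o_def
    by (rule has_derivative_eq_rhs) (auto simp: algebra_simps)
qed

lemma has_grad_real:
  assumes "(\<phi> has_real_derivative d) (at (f z))" "has_grad f p q z"
  shows "has_grad (\<lambda>z. \<phi> (f z)) (d * p) (d * q) z"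
  using diff_chain_at[OF assms(2)[unfolded has_grad_def] assms(1)[unfolded has_field_derivative_def]]
  unfolding has_grad_def by (auto simp: o_def case_prod_beta algebra_simps elim!: has_derivative_eq_rhs)

text \<open>Writing the derivative as the function itself over 2x covers both signs of x and lets
  the induction in \<open>C_on_sqrt_abs\<close> return to its own hypothesis.\<close>

lemma has_real_derivative_sqrt_abs:
  assumes "x \<noteq> (0 :: real)"
  shows "((\<lambda>x. sqrt \<bar>x\<bar>) has_real_derivative sqrt \<bar>x\<bar> / (2 * x)) (at x)"
proof -
  have "sqrt \<bar>x\<bar> * sqrt \<bar>x\<bar> = \<bar>x\<bar>" by simp
  then have "inverse (sqrt \<bar>x\<bar>) / 2 * sgn x = sqrt \<bar>x\<bar> / (2 * x)"
    using assms by (auto simp: field_simps sgn_if abs_if split: if_splits)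
  moreover have "(abs has_real_derivative sgn x) (at x)"
  proof (cases "x > 0")
    case True
    have "(abs has_real_derivative 1) (at x)"
      by (rule has_field_derivative_transform_within_open[of "\<lambda>x. x" _ _ "{0<..}"]) (use True in auto)
    with True show ?thesis by simp
  next
    case False
    have "(abs has_real_derivative -1) (at x)"
      by (rule has_field_derivative_transform_within_open[of uminus _ _ "{..<0}"])
        (use False assms in \<open>auto intro!: derivative_eq_intros\<close>)
    with False assms show ?thesis by simp
  qed
  then have "((\<lambda>x. sqrt \<bar>x\<bar>) has_real_derivative inverse (sqrt \<bar>x\<bar>) / 2 * sgn x) (at x)"
    using assms by (intro DERIV_chain2[OF DERIV_real_sqrt]) auto
  ultimately show ?thesis by (simp only:)
qed

section \<open>Differentiability classes and their closure properties\<close>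

lemma C_on_SucI:
  "(\<And>z. z \<in> D \<Longrightarrow> has_grad f (p z) (q z) z) \<Longrightarrow> C_on k p D \<Longrightarrow> C_on k q D \<Longrightarrow> C_on (Suc k) f D"
  unfolding C_on.simps(2) has_grad_def by blast

lemma C_on_SucE:
  assumes "C_on (Suc k) f D"
  obtains p q where "\<And>z. z \<in> D \<Longrightarrow> has_grad f (p z) (q z) z" "C_on k p D" "C_on k q D"
  using assms by (auto simp: has_grad_def)

declare C_on.simps(2) [simp del]

lemma C_on_subset: "C_on k f D \<Longrightarrow> E \<subseteq> D \<Longrightarrow> C_on k f E"
proof (induction k arbitrary: f)
  case (Suc k)
  obtain p q where pq: "\<And>z. z \<in> D \<Longrightarrow> has_grad f (p z) (q z) z" "C_on k p D" "C_on k q D"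
    using Suc.prems C_on_SucE by metis
  show ?case
    by (rule C_on_SucI[of _ _ p q]) (use pq Suc in auto)
qed (auto intro: continuous_on_subset)

text \<open>On an open set the gradients of \<open>f\<close> are also those of \<open>g\<close>, so
  the same witnesses serve and a case distinction replaces induction.\<close>

lemma C_on_cong:
  "C_on k f D \<Longrightarrow> open D \<Longrightarrow> (\<And>z. z \<in> D \<Longrightarrow> f z = g z) \<Longrightarrow> C_on k g D"
proof (cases k)
  case (Suc n)
  assume "open D" and eq: "\<And>z. z \<in> D \<Longrightarrow> f z = g z" and "C_on k f D"
  then obtain p q where pq: "\<And>z. z \<in> D \<Longrightarrow> has_grad f (p z) (q z) z" "C_on n p D" "C_on n q D"
    using Suc C_on_SucE by metis
  have "has_grad g (p z) (q z) z" if "z \<in> D" for z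
    using has_grad_cong[OF pq(1)[OF that] \<open>open D\<close> that eq] .
  then show ?thesis unfolding Suc by (intro C_on_SucI[of _ _ p q] pq)
qed (auto cong: continuous_on_cong)

text \<open>In the product and chain rules the undifferentiated functions reappear inside the
  gradients, where order \<open>k\<close> is asked for but order \<open>Suc k\<close> is
  given.\<close>

lemma C_on_SucD: "C_on (Suc k) f D \<Longrightarrow> C_on k f D"
proof (induction k arbitrary: f)
  case 0
  then obtain p q where "\<And>z. z \<in> D \<Longrightarrow> has_grad f (p z) (q z) z"
    using C_on_SucE by metis
  then show ?case
    by (auto intro!: continuous_at_imp_continuous_on simp: has_grad_def dest: has_derivative_continuous)
next
  case (Suc k)
  from Suc.prems obtain p q where "\<And>z. z \<in> D \<Longrightarrow> has_grad f (p z) (q z) z"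
      "C_on (Suc k) p D" "C_on (Suc k) q D"
    using C_on_SucE by blast
  then show ?case by (rule C_on_SucI[of _ _ p q, OF _ Suc.IH Suc.IH])
qed

lemma C_on_const: "C_on k (\<lambda>z. c) D"
  by (induction k arbitrary: c) (auto intro!: C_on_SucI has_grad_const)

lemma C_on_fst: "C_on k fst D"
  by (cases k) (auto intro!: C_on_SucI has_grad_fst C_on_const continuous_on_fst)

lemma C_on_snd: "C_on k snd D"
  by (cases k) (auto intro!: C_on_SucI has_grad_snd C_on_const continuous_on_snd)

lemma C_on_add: "C_on k f D \<Longrightarrow> C_on k g D \<Longrightarrow> C_on k (\<lambda>z. f z + g z) D"
proof (induction k arbitrary: f g)
  case (Suc k)
  obtain p q where pq: "\<And>z. z \<in> D \<Longrightarrow> has_grad f (p z) (q z) z" "C_on k p D" "C_on k q D"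
    using Suc.prems C_on_SucE by metis
  obtain p' q' where pq': "\<And>z. z \<in> D \<Longrightarrow> has_grad g (p' z) (q' z) z" "C_on k p' D" "C_on k q' D"
    using Suc.prems C_on_SucE by metis
  show ?case
    by (rule C_on_SucI[OF has_grad_add[OF pq(1) pq'(1)]]) (use pq pq' Suc.IH in auto)
qed (auto intro: continuous_on_add)

lemma C_on_mult: "C_on k f D \<Longrightarrow> C_on k g D \<Longrightarrow> C_on k (\<lambda>z. f z * g z) D"
proof (induction k arbitrary: f g)
  case (Suc k)
  obtain p q where pq: "\<And>z. z \<in> D \<Longrightarrow> has_grad f (p z) (q z) z" "C_on k p D" "C_on k q D"
    using Suc.prems C_on_SucE by metis
  obtain p' q' where pq': "\<And>z. z \<in> D \<Longrightarrow> has_grad g (p' z) (q' z) z" "C_on k p' D" "C_on k q' D"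
    using Suc.prems C_on_SucE by metis
  show ?case
    by (rule C_on_SucI[OF has_grad_mult[OF pq(1) pq'(1)]])
      (use pq pq' Suc C_on_SucD in \<open>auto intro!: C_on_add Suc.IH\<close>)
qed (auto intro: continuous_on_mult)

lemma C_on_chain:
  "C_on k f E \<Longrightarrow> C_on k g D \<Longrightarrow> C_on k h D \<Longrightarrow> (\<And>z. z \<in> D \<Longrightarrow> (g z, h z) \<in> E) \<Longrightarrow>
     C_on k (\<lambda>z. f (g z, h z)) D"
proof (induction k arbitrary: f)
  case 0
  then have "continuous_on ((\<lambda>z. (g z, h z)) ` D) f"
    by (auto intro: continuous_on_subset)
  with 0 show ?case
    by (auto intro: continuous_on_compose2[of E f D "\<lambda>z. (g z, h z)"] continuous_on_Pair)
next
  case (Suc k)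
  obtain p q where pq: "\<And>z. z \<in> E \<Longrightarrow> has_grad f (p z) (q z) z" "C_on k p E" "C_on k q E"
    using Suc.prems C_on_SucE by metis
  obtain p1 q1 where 1: "\<And>z. z \<in> D \<Longrightarrow> has_grad g (p1 z) (q1 z) z" "C_on k p1 D" "C_on k q1 D"
    using Suc.prems C_on_SucE by metis
  obtain p2 q2 where 2: "\<And>z. z \<in> D \<Longrightarrow> has_grad h (p2 z) (q2 z) z" "C_on k p2 D" "C_on k q2 D"
    using Suc.prems C_on_SucE by metis
  show ?case
    by (rule C_on_SucI[OF has_grad_chain[OF pq(1) 1(1) 2(1)]])
      (use pq 1 2 Suc.prems in
        \<open>auto simp only: intro!: C_on_add C_on_mult Suc.IH C_on_SucD[OF Suc.prems(2)] C_on_SucD[OF Suc.prems(3)]\<close>)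
qed

lemma C_on_exp: "C_on k f D \<Longrightarrow> C_on k (\<lambda>z. exp (f z)) D"
proof (induction k)
  case (Suc k)
  obtain p q where pq: "\<And>z. z \<in> D \<Longrightarrow> has_grad f (p z) (q z) z" "C_on k p D" "C_on k q D"
    using Suc.prems C_on_SucE by metis
  show ?case
    by (rule C_on_SucI[OF has_grad_real[OF DERIV_exp pq(1)]])
      (use pq Suc C_on_SucD in \<open>auto intro!: C_on_mult Suc.IH\<close>)
qed (auto intro: continuous_on_exp)

lemma C_on_inverse: "C_on k f D \<Longrightarrow> (\<And>z. z \<in> D \<Longrightarrow> f z \<noteq> 0) \<Longrightarrow> C_on k (\<lambda>z. inverse (f z)) D"
proof (induction k)
  case (Suc k)
  obtain p q where pq: "\<And>z. z \<in> D \<Longrightarrow> has_grad f (p z) (q z) z" "C_on k p D" "C_on k q D"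
    using Suc.prems C_on_SucE by metis
  \<comment> \<open>A product of reciprocals, so that the induction hypothesis applies to each
    factor.\<close>
  have "((\<lambda>x. inverse x) has_real_derivative (-1) * (inverse (f z) * inverse (f z))) (at (f z))"
    if "z \<in> D" for z
    using Suc.prems(2)[OF that] by (auto intro!: derivative_eq_intros)
  then show ?case
    by (rule C_on_SucI[OF has_grad_real[OF _ pq(1)]])
      (use pq in \<open>auto simp only: intro!: C_on_mult C_on_const Suc.IH C_on_SucD[OF Suc.prems(1)] Suc.prems(2)\<close>)
qed (auto intro: continuous_on_inverse)

lemma C_on_divide:
  "C_on k f D \<Longrightarrow> C_on k g D \<Longrightarrow> (\<And>z. z \<in> D \<Longrightarrow> g z \<noteq> 0) \<Longrightarrow> C_on k (\<lambda>z. f z / g z) D"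
  unfolding divide_inverse by (intro C_on_mult C_on_inverse)

lemma C_on_sqrt_abs:
  "C_on k f D \<Longrightarrow> (\<And>z. z \<in> D \<Longrightarrow> f z \<noteq> 0) \<Longrightarrow> C_on k (\<lambda>z. sqrt \<bar>f z\<bar>) D"
proof (induction k)
  case (Suc k)
  obtain p q where pq: "\<And>z. z \<in> D \<Longrightarrow> has_grad f (p z) (q z) z" "C_on k p D" "C_on k q D"
    using Suc.prems C_on_SucE by metis
  show ?case
    by (rule C_on_SucI[OF has_grad_real[OF has_real_derivative_sqrt_abs pq(1)]])
      (use pq in \<open>auto simp: Suc.prems(2) intro!: C_on_mult C_on_const C_on_divide Suc.IH C_on_SucD[OF Suc.prems(1)]\<close>)
qed (auto intro!: continuous_intros)

text \<open>The derivative witnesses of one member say nothing outside it. The canonical choice by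
  \<open>frechet_derivative\<close> agrees with each of them on its own open set and so glues them
  together.\<close>

lemma C_on_Union:
  assumes "\<And>U. U \<in> \<U> \<Longrightarrow> open U" "\<And>U. U \<in> \<U> \<Longrightarrow> C_on k f U"
  shows "C_on k f (\<Union>\<U>)"
  using assms(2)
proof (induction k arbitrary: f)
  case 0
  then show ?case using assms(1) by (auto intro: continuous_on_open_Union)
next
  case (Suc k)
  define p q where "p z = frechet_derivative f (at z) (1, 0)"
    and "q z = frechet_derivative f (at z) (0, 1)" for z
  have pq: "p' = p z \<and> q' = q z" if "has_grad f p' q' z" for p' q' z
    using frechet_derivative_at[OF that[unfolded has_grad_def], symmetric] by (simp add: p_def q_def)
  have *: "(\<forall>z\<in>U. has_grad f (p z) (q z) z) \<and> C_on k p U \<and> C_on k q U" if U: "U \<in> \<U>" for U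
  proof -
    obtain p' q' where 1: "\<And>z. z \<in> U \<Longrightarrow> has_grad f (p' z) (q' z) z" "C_on k p' U" "C_on k q' U"
      using Suc.prems[OF U] C_on_SucE by blast
    then have "\<And>z. z \<in> U \<Longrightarrow> p' z = p z \<and> q' z = q z" using pq by blast
    with 1 show ?thesis using assms(1)[OF U] C_on_cong by metis
  qed
  then show ?case by (intro C_on_SucI[of _ f p q] Suc.IH) auto
qed

section \<open>Solutions of the heat equation\<close>

definition heat_on :: "(real \<times> real \<Rightarrow> real) \<Rightarrow> (real \<times> real) set \<Rightarrow> bool" where
  "heat_on f D \<longleftrightarrow> open D \<and> (\<forall>k. C_on k f D) \<and>
     (\<exists>p q r. \<forall>z\<in>D. has_grad f (p z) (q z) z \<and> has_grad q (r z) (p z) z)"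

lemma heat_onI:
  assumes "open D" "\<And>k. C_on k f D" "\<And>z. z \<in> D \<Longrightarrow> has_grad f (p z) (q z) z"
    "\<And>z. z \<in> D \<Longrightarrow> has_grad q (r z) (p z) z"
  shows "heat_on f D"
  unfolding heat_on_def using assms by metis

lemma heat_onE:
  assumes "heat_on f D"
  obtains p q r where "open D" "\<And>k. C_on k f D" "\<And>z. z \<in> D \<Longrightarrow> has_grad f (p z) (q z) z"
    "\<And>z. z \<in> D \<Longrightarrow> has_grad q (r z) (p z) z"
  using assms unfolding heat_on_def by metis

lemma deriv_fst_eq:
  assumes "has_grad f p q (t, x)"
  shows "deriv (\<lambda>s. f (s, x)) t = p"
proof -
  have "((\<lambda>s. (s, x)) has_derivative (\<lambda>a. (a, 0))) (at t)"
    by (auto intro!: derivative_eq_intros)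
  from diff_chain_at[OF this assms[unfolded has_grad_def]] show ?thesis
    by (intro DERIV_imp_deriv) (simp add: has_field_derivative_def o_def)
qed

lemma deriv_snd_eq:
  assumes "has_grad f p q (t, x)"
  shows "deriv (\<lambda>y. f (t, y)) x = q"
proof -
  have "((\<lambda>y. (t, y)) has_derivative (\<lambda>a. (0, a))) (at x)"
    by (auto intro!: derivative_eq_intros)
  from diff_chain_at[OF this assms[unfolded has_grad_def]] show ?thesis
    by (intro DERIV_imp_deriv) (simp add: has_field_derivative_def o_def)
qed

text \<open>The outer derivative sees the inner one on a neighbourhood of \<open>x\<close>, hence
  the open slice of \<open>D\<close> at \<open>t\<close>.\<close>

lemma deriv2_snd_eq:
  assumes "open D" "(t, x) \<in> D" "\<And>z. z \<in> D \<Longrightarrow> has_grad f (p z) (q z) z" "has_grad q r s (t, x)"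
  shows "(deriv ^^ 2) (\<lambda>y. f (t, y)) x = s"
proof -
  have "open (Pair t -` D)" by (intro open_vimage assms continuous_intros)
  then have "\<forall>\<^sub>F y in nhds x. y \<in> Pair t -` D"
    using assms(2) by (intro eventually_nhds_in_open) auto
  then have "\<forall>\<^sub>F y in nhds x. deriv (\<lambda>y. f (t, y)) y = q (t, y)"
    by eventually_elim (use assms(3) deriv_snd_eq in blast)
  then have "deriv (deriv (\<lambda>y. f (t, y))) x = deriv (\<lambda>y. q (t, y)) x"
    by (intro deriv_cong_ev) auto
  then show ?thesis using deriv_snd_eq[OF assms(4)] by (simp add: numeral_2_eq_2)
qed

text \<open>In \<open>heat_on\<close> the equation is expressed by sharing: one function
  \<open>p\<close> is both the t-derivative of \<open>f\<close> and the x-derivative of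
  \<open>q\<close>, the x-derivative of \<open>f\<close>. This replaces iterated
  \<open>deriv\<close> by gradient calculus. The two forms agree because C^2 smoothness supplies
  witnesses and gradients are unique.\<close>

lemma local_solution_iff: "local_solution h \<longleftrightarrow> dom h \<noteq> {} \<and> heat_on (the \<circ> h) (dom h)"
proof -
  have "(\<forall>(t, x)\<in>D. deriv (\<lambda>s. f (s, x)) t = (deriv ^^ 2) (\<lambda>y. f (t, y)) x) \<longleftrightarrow>
      (\<exists>p q r. \<forall>z\<in>D. has_grad f (p z) (q z) z \<and> has_grad q (r z) (p z) z)"
    if "open D" "C_on (Suc (Suc 0)) f D" for f :: "real \<times> real \<Rightarrow> real" and D
  proof -
    note C2 = that(2)
    obtain p q where 1: "\<And>z. z \<in> D \<Longrightarrow> has_grad f (p z) (q z) z" "C_on (Suc 0) p D" "C_on (Suc 0) q D"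
      using C2 by (rule C_on_SucE) blast
    obtain r s where 2: "\<And>z. z \<in> D \<Longrightarrow> has_grad q (r z) (s z) z"
      using 1(3) by (rule C_on_SucE) blast
    have pde: "(case z of (t, x) \<Rightarrow> deriv (\<lambda>s. f (s, x)) t = (deriv ^^ 2) (\<lambda>y. f (t, y)) x) \<longleftrightarrow>
        p z = s z" if "z \<in> D" for z
      using deriv_fst_eq 1 2 deriv2_snd_eq[OF \<open>open D\<close> _ 1(1)] that
      by (cases z) (metis (mono_tags, lifting) case_prod_conv)
    \<comment> \<open>Arbitrary witnesses coincide with the chosen ones on \<open>D\<close> only;
      openness of \<open>D\<close> still lets the gradient of \<open>q'\<close> pass to
      \<open>q\<close>.\<close>
    have "p z = s z" if 3: "\<forall>z\<in>D. has_grad f (p' z) (q' z) z \<and> has_grad q' (r' z) (p' z) z"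
      and "z \<in> D" for p' q' r' z
    proof -
      have "has_grad q (r' z) (p' z) z"
        using has_grad_cong[of q' "r' z" "p' z" z D q] 1 3 \<open>z \<in> D\<close> \<open>open D\<close> has_grad_unique by blast
      then show ?thesis using 1 2 3 \<open>z \<in> D\<close> has_grad_unique by metis
    qed
    moreover have "\<exists>p q r. \<forall>z\<in>D. has_grad f (p z) (q z) z \<and> has_grad q (r z) (p z) z"
      if "\<forall>z\<in>D. p z = s z"
      using 1 2 that by metis
    ultimately show ?thesis using pde by blast
  qed
  from this[of "dom h" "the \<circ> h"] show ?thesis
    unfolding local_solution_def heat_on_def o_def by auto
qed

lemma heat_on_cong:
  assumes "heat_on f D" "\<And>z. z \<in> D \<Longrightarrow> f z = g z"
  shows "heat_on g D"
proof -
  obtain p q r where 1: "open D" "\<And>k. C_on k f D" "\<And>z. z \<in> D \<Longrightarrow> has_grad f (p z) (q z) z"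
    "\<And>z. z \<in> D \<Longrightarrow> has_grad q (r z) (p z) z"
    using assms(1) by (rule heat_onE) blast
  show ?thesis
  proof (rule heat_onI[OF 1(1) _ _ 1(4)])
    show "C_on k g D" for k using C_on_cong 1 assms(2) by blast
    show "has_grad g (p z) (q z) z" if "z \<in> D" for z
      using has_grad_cong[OF 1(3)[OF that] 1(1) that assms(2)] .
  qed
qed

lemma heat_on_subset:
  assumes "heat_on f D" "open E" "E \<subseteq> D"
  shows "heat_on f E"
proof -
  obtain p q r where 1: "open D" "\<And>k. C_on k f D" "\<And>z. z \<in> D \<Longrightarrow> has_grad f (p z) (q z) z"
    "\<And>z. z \<in> D \<Longrightarrow> has_grad q (r z) (p z) z"
    using assms(1) by (rule heat_onE) blast
  with assms(2,3) show ?thesis by (intro heat_onI[of E f p q r] C_on_subset[OF 1(2)]) auto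
qed

text \<open>Canonical derivatives glue local witnesses as in \<open>C_on_Union\<close>. This makes
  the union of the parameter functions of all extensions of a composition a solution again.\<close>

lemma heat_on_Union:
  assumes "\<And>U. U \<in> \<U> \<Longrightarrow> heat_on f U"
  shows "heat_on f (\<Union>\<U>)"
proof -
  define p q where "p z = frechet_derivative f (at z) (1, 0)"
    and "q z = frechet_derivative f (at z) (0, 1)" for z
  define r where "r z = frechet_derivative q (at z) (1, 0)" for z
  have pq: "p' = p z \<and> q' = q z" if "has_grad f p' q' z" for p' q' z
    using frechet_derivative_at[OF that[unfolded has_grad_def], symmetric] by (simp add: p_def q_def)
  have r: "r' = r z" if "has_grad q r' p' z" for r' p' z
    using frechet_derivative_at[OF that[unfolded has_grad_def], symmetric] by (simp add: r_def)
  have *: "has_grad f (p z) (q z) z \<and> has_grad q (r z) (p z) z" if U: "U \<in> \<U>" "z \<in> U" for U z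
  proof -
    obtain p' q' r' where 1: "open U" "\<And>k. C_on k f U" "\<And>z. z \<in> U \<Longrightarrow> has_grad f (p' z) (q' z) z"
        "\<And>z. z \<in> U \<Longrightarrow> has_grad q' (r' z) (p' z) z"
      using assms[OF U(1)] by (rule heat_onE) blast
    have 2: "p' w = p w \<and> q' w = q w" if "w \<in> U" for w using pq 1(3) that by blast
    have "has_grad q (r' z) (p' z) z"
      by (rule has_grad_cong[OF 1(4)[OF U(2)] 1(1) U(2)]) (use 2 in blast)
    with 1(3)[OF U(2)] 2[OF U(2)] r show ?thesis by metis
  qed
  have "open (\<Union>\<U>)" "C_on k f (\<Union>\<U>)" for k
    using assms C_on_Union[of \<U>] unfolding heat_on_def by auto
  then show ?thesis by (rule heat_onI[of _ f p q r]) (use * in auto)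
qed

lemma heat_on_zero: "open D \<Longrightarrow> heat_on (\<lambda>z. 0) D"
  by (rule heat_onI[of _ _ "\<lambda>z. 0" "\<lambda>z. 0" "\<lambda>z. 0"]) (auto intro: C_on_const has_grad_const)

lemma heat_on_add:
  assumes "heat_on f D" "heat_on g D"
  shows "heat_on (\<lambda>z. f z + g z) D"
proof -
  obtain p q r where 1: "open D" "\<And>k. C_on k f D" "\<And>z. z \<in> D \<Longrightarrow> has_grad f (p z) (q z) z"
    "\<And>z. z \<in> D \<Longrightarrow> has_grad q (r z) (p z) z"
    using assms(1) by (rule heat_onE) blast
  obtain p' q' r' where 2: "open D" "\<And>k. C_on k g D" "\<And>z. z \<in> D \<Longrightarrow> has_grad g (p' z) (q' z) z"
    "\<And>z. z \<in> D \<Longrightarrow> has_grad q' (r' z) (p' z) z"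
    using assms(2) by (rule heat_onE) blast
  show ?thesis
    by (rule heat_onI[OF 1(1) C_on_add[OF 1(2) 2(2)] has_grad_add[OF 1(3) 2(3)] has_grad_add[OF 1(4) 2(4)]])
qed

lemma heat_on_cmult:
  assumes "heat_on f D"
  shows "heat_on (\<lambda>z. c * f z) D"
proof -
  obtain p q r where 1: "open D" "\<And>k. C_on k f D" "\<And>z. z \<in> D \<Longrightarrow> has_grad f (p z) (q z) z"
    "\<And>z. z \<in> D \<Longrightarrow> has_grad q (r z) (p z) z"
    using assms(1) by (rule heat_onE) blast
  have "has_grad (\<lambda>z. c * f z) (c * p z) (c * q z) z" "has_grad (\<lambda>z. c * q z) (c * r z) (c * p z) z"
    if "z \<in> D" for z
    using has_grad_mult[OF has_grad_const 1(3)[OF that]] has_grad_mult[OF has_grad_const 1(4)[OF that]]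
    by simp_all
  then show ?thesis by (rule heat_onI[OF 1(1) C_on_mult[OF C_on_const 1(2)]])
qed

text \<open>Here \<open>b\<close> and \<open>d\<close> are the logarithmic derivatives of the factor \<open>B\<close>. The first-order terms of
  \<open>(f \<circ> (T, X)) B\<close> cancel in the heat equation because \<open>X\<^sub>t = 2 X\<^sub>x b\<close>, the second-order ones match
  because \<open>T\<^sub>t = X\<^sub>x\<^sup>2\<close>, and the last assumption says that \<open>B\<close> itself is a solution.\<close>

lemma heat_on_transform:
  assumes f: "heat_on f D" and E: "open E" "\<And>z. z \<in> E \<Longrightarrow> (T z, X z) \<in> D"
    and C: "\<And>k. C_on k T E" "\<And>k. C_on k X E" "\<And>k. C_on k B E"
    and T: "\<And>z. z \<in> E \<Longrightarrow> has_grad T ((a z)\<^sup>2) 0 z"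
    and X: "\<And>z. z \<in> E \<Longrightarrow> has_grad X (2 * a z * b z) (a z) z"
    and a: "\<And>z. z \<in> E \<Longrightarrow> has_grad a (a' z) 0 z"
    and B: "\<And>z. z \<in> E \<Longrightarrow> has_grad B (B z * d z) (B z * b z) z"
    and b: "\<And>z. z \<in> E \<Longrightarrow> has_grad b (b' z) (d z - (b z)\<^sup>2) z"
  shows "heat_on (\<lambda>z. f (T z, X z) * B z) E"
proof -
  obtain p q r where 1: "open D" "\<And>k. C_on k f D" "\<And>z. z \<in> D \<Longrightarrow> has_grad f (p z) (q z) z"
    "\<And>z. z \<in> D \<Longrightarrow> has_grad q (r z) (p z) z"
    using f by (rule heat_onE) blast
  define g where "g z = (q (T z, X z) * a z) * B z + f (T z, X z) * (B z * b z)" for z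
  show ?thesis
  proof (rule heat_onI[of _ _ "\<lambda>z. (p (T z, X z) * (a z)\<^sup>2 + q (T z, X z) * (2 * a z * b z)) * B z
        + f (T z, X z) * (B z * d z)" g])
    show "C_on k (\<lambda>z. f (T z, X z) * B z) E" for k
      by (intro C_on_mult C C_on_chain[OF 1(2)] E)
  next
    fix z assume z: "z \<in> E"
    show "has_grad (\<lambda>z. f (T z, X z) * B z)
        ((p (T z, X z) * (a z)\<^sup>2 + q (T z, X z) * (2 * a z * b z)) * B z + f (T z, X z) * (B z * d z)) (g z) z"
      by (rule has_grad_eq[OF has_grad_mult[OF has_grad_chain[OF 1(3)[OF E(2)] T X] B]])
        (simp_all add: g_def z)
    \<comment> \<open>The first entry is the mixed derivative, of which only the existence matters;
      the second repeats the t-derivative above, which is the heat equation.\<close>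
    show "has_grad g ((((r (T z, X z) * (a z)\<^sup>2 + p (T z, X z) * (2 * a z * b z)) * a z + q (T z, X z) * a' z) * B z
        + q (T z, X z) * a z * (B z * d z))
        + ((p (T z, X z) * (a z)\<^sup>2 + q (T z, X z) * (2 * a z * b z)) * (B z * b z) +
           f (T z, X z) * (B z * d z * b z + B z * b' z)))
        ((p (T z, X z) * (a z)\<^sup>2 + q (T z, X z) * (2 * a z * b z)) * B z + f (T z, X z) * (B z * d z)) z"
      unfolding g_def
      by (rule has_grad_eq[OF has_grad_add[OF
            has_grad_mult[OF has_grad_mult[OF has_grad_chain[OF 1(4)[OF E(2)] T X] a] B]
            has_grad_mult[OF has_grad_chain[OF 1(3)[OF E(2)] T X] has_grad_mult[OF B b]]]])
        (simp_all add: z algebra_simps power2_eq_square)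
  qed (rule E)
qed

lemma has_grad_cmult: "has_grad f p q z \<Longrightarrow> has_grad (\<lambda>z. c * f z) (c * p) (c * q) z"
  using has_grad_mult[OF has_grad_const[of c]] by simp

lemma has_grad_inverse:
  "has_grad f p q z \<Longrightarrow> f z \<noteq> 0 \<Longrightarrow> has_grad (\<lambda>z. inverse (f z)) (- p / (f z)\<^sup>2) (- q / (f z)\<^sup>2) z"
  by (rule has_grad_eq[OF has_grad_real[OF DERIV_inverse]])
    (auto simp: power2_eq_square divide_inverse)

lemma has_grad_divide:
  "has_grad f p q z \<Longrightarrow> has_grad g p' q' z \<Longrightarrow> g z \<noteq> 0 \<Longrightarrow>
     has_grad (\<lambda>z. f z / g z) ((p * g z - f z * p') / (g z)\<^sup>2) ((q * g z - f z * q') / (g z)\<^sup>2) z"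
  unfolding divide_inverse[of "f _"]
  by (rule has_grad_eq[OF has_grad_mult[OF _ has_grad_inverse]])
    (auto simp: field_simps power2_eq_square)

section \<open>Coefficients and composition\<close>

text \<open>\<open>den\<close>, \<open>proj\<close> and \<open>amp\<close> separate the singular
  line, the action on (t, x) and the slope in u; only \<open>amp\<close> involves \<sigma>.\<close>

definition den :: "coeffs \<Rightarrow> real \<Rightarrow> real" where
  "den = (\<lambda>(\<alpha>, \<beta>, \<gamma>, \<delta>, l1, l0, \<sigma>) t. \<gamma> * t + \<delta>)"

definition proj :: "coeffs \<Rightarrow> real \<times> real \<Rightarrow> real \<times> real" where
  "proj = (\<lambda>(\<alpha>, \<beta>, \<gamma>, \<delta>, l1, l0, \<sigma>) z.
     ((\<alpha> * fst z + \<beta>) / (\<gamma> * fst z + \<delta>), (snd z + l1 * fst z + l0) / (\<gamma> * fst z + \<delta>)))"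

definition amp :: "coeffs \<Rightarrow> real \<times> real \<Rightarrow> real" where
  "amp = (\<lambda>(\<alpha>, \<beta>, \<gamma>, \<delta>, l1, l0, \<sigma>) z. \<sigma> * sqrt \<bar>\<gamma> * fst z + \<delta>\<bar> *
     exp (\<gamma> * (snd z + l1 * fst z + l0)^2 / (4 * (\<gamma> * fst z + \<delta>)) - l1 / 2 * snd z - l1^2 / 4 * fst z))"

definition u_factor :: "coeffs \<Rightarrow> real" where
  "u_factor = (\<lambda>(\<alpha>, \<beta>, \<gamma>, \<delta>, l1, l0, \<sigma>). \<sigma>)"

lemma Phi_eq:
  "Phi c h (t, x, u) = (if (t, x) \<in> dom h \<and> den c t \<noteq> 0
     then Some (fst (proj c (t, x)), snd (proj c (t, x)), amp c (t, x) * (u + the (h (t, x)))) else None)"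
  by (cases c) (simp add: Phi_def den_def proj_def amp_def)

lemma amp_nonzero: "c \<in> coeffs_space \<Longrightarrow> den c (fst z) \<noteq> 0 \<Longrightarrow> amp c z \<noteq> 0"
  by (cases c) (auto simp: coeffs_space_def amp_def den_def)

text \<open>The invariance of the heat equation under the pseudogroup, as an instance of
  \<open>heat_on_transform\<close> with the factor B = 1 / amp.\<close>

lemma heat_on_pullback:
  assumes c: "c \<in> coeffs_space" and f: "heat_on f D"
  shows "heat_on (\<lambda>z. f (proj c z) / amp c z) {z. den c (fst z) \<noteq> 0 \<and> proj c z \<in> D}" (is "heat_on _ ?E")
proof -
  obtain \<alpha> \<beta> \<gamma> \<delta> l m \<sigma> where c_eq: "c = (\<alpha>, \<beta>, \<gamma>, \<delta>, l, m, \<sigma>)" by (metis prod_cases7)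
  have det: "\<alpha> * \<delta> - \<beta> * \<gamma> = 1" and \<sigma>: "\<sigma> \<noteq> 0" using c by (auto simp: coeffs_space_def c_eq)
  define Q where "Q z = \<gamma> * fst z + \<delta>" for z :: "real \<times> real"
  define Y where "Y z = snd z + l * fst z + m" for z :: "real \<times> real"
  define T where "T z = (\<alpha> * fst z + \<beta>) / Q z" for z :: "real \<times> real"
  define X where "X z = Y z / Q z" for z :: "real \<times> real"
  define E where "E z = \<gamma> / 4 * (Y z * X z) + (- l / 2 * snd z + - (l\<^sup>2) / 4 * fst z)" for z :: "real \<times> real"
  define a where "a z = inverse (Q z)" for z :: "real \<times> real"
  \<comment> \<open>The x-derivative of -E, hence the logarithmic x-derivative of \<open>B\<close>:
    the square root does not depend on x.\<close>
  define b where "b z = - \<gamma> / 2 * X z + l / 2" for z :: "real \<times> real"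
  have proj: "proj c z = (T z, X z)" and den: "den c (fst z) = Q z"
    and amp: "amp c z = \<sigma> * (sqrt \<bar>Q z\<bar> * exp (E z))" for z
    by (simp_all add: proj_def den_def amp_def c_eq Q_def Y_def T_def X_def E_def power2_eq_square)
  define B where "B z = inverse \<sigma> * (inverse (sqrt \<bar>Q z\<bar>) * exp (- 1 * E z))" for z
  have B: "f (proj c z) / amp c z = f (T z, X z) * B z" for z
    by (simp add: proj amp B_def divide_inverse exp_minus)
  let ?U = "{z. Q z \<noteq> 0}"
  have CQ: "C_on k Q D" and CY: "C_on k Y D" for k D
    unfolding Q_def Y_def by (intro C_on_add C_on_mult C_on_const C_on_fst C_on_snd)+
  have CT: "C_on k T ?U" and CX: "C_on k X ?U" for k
    unfolding T_def X_def by (intro C_on_divide C_on_add C_on_mult C_on_const C_on_fst CQ CY; simp)+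
  have "C_on k E ?U" for k
    unfolding E_def by (intro C_on_add C_on_mult C_on_const C_on_fst C_on_snd CY CX)
  then have CB: "C_on k B ?U" for k
    unfolding B_def by (intro C_on_mult C_on_const C_on_inverse C_on_sqrt_abs C_on_exp CQ) auto
  have QG: "has_grad Q \<gamma> 0 z" for z
    unfolding Q_def
    by (rule has_grad_eq[OF has_grad_add[OF has_grad_cmult[OF has_grad_fst] has_grad_const]]) auto
  have YG: "has_grad Y l 1 z" for z
    unfolding Y_def
    by (rule has_grad_eq[OF has_grad_add[OF has_grad_add[OF has_grad_snd has_grad_cmult[OF has_grad_fst]] has_grad_const]]) auto
  have aG: "has_grad a (- \<gamma> / (Q z)\<^sup>2) 0 z" if "Q z \<noteq> 0" for z
    unfolding a_def by (rule has_grad_eq[OF has_grad_inverse[OF QG that]]) auto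
  have TG: "has_grad T ((a z)\<^sup>2) 0 z" if "Q z \<noteq> 0" for z
  proof -
    \<comment> \<open>The numerator in the quotient rule is the determinant, so the t-derivative of
      \<open>T\<close> is the square of \<open>a\<close>.\<close>
    have "\<alpha> * Q z - (\<alpha> * fst z + \<beta>) * \<gamma> = 1" using det by (simp add: Q_def algebra_simps)
    then show ?thesis
      unfolding T_def
      by (intro has_grad_eq[OF has_grad_divide[OF has_grad_add[OF has_grad_cmult[OF has_grad_fst] has_grad_const] QG that]])
        (auto simp: a_def divide_inverse power_inverse)
  qed
  have XG: "has_grad X (2 * a z * b z) (a z) z" if "Q z \<noteq> 0" for z
    unfolding X_def
    by (rule has_grad_eq[OF has_grad_divide[OF YG QG that]])
      (use that in \<open>auto simp: a_def b_def X_def field_simps power2_eq_square\<close>)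
  \<comment> \<open>The logarithmic t-derivative of \<open>B\<close>: the first summand stems from
    the square root, the second from the exponent. As the first is also the x-derivative of
    \<open>b\<close>, the factor \<open>B\<close> solves the heat equation.\<close>
  define d where "d z = - \<gamma> / (2 * Q z) + (b z)\<^sup>2" for z
  have bG: "has_grad b (- \<gamma> / 2 * (2 * a z * b z)) (d z - (b z)\<^sup>2) z" if "Q z \<noteq> 0" for z
    unfolding b_def
    by (rule has_grad_eq[OF has_grad_add[OF has_grad_cmult[OF XG[OF that]] has_grad_const]])
      (use that in \<open>auto simp: a_def b_def d_def field_simps\<close>)
  have EG: "has_grad E (- (b z)\<^sup>2) (- b z) z" if "Q z \<noteq> 0" for z
    unfolding E_def
    by (rule has_grad_eq[OF has_grad_add[OF has_grad_cmult[OF has_grad_mult[OF YG XG[OF that]]]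
            has_grad_add[OF has_grad_cmult[OF has_grad_snd] has_grad_cmult[OF has_grad_fst]]]])
      (use that in \<open>auto simp: a_def b_def X_def field_simps power2_eq_square\<close>)
  have SG: "has_grad (\<lambda>z. inverse (sqrt \<bar>Q z\<bar>)) (inverse (sqrt \<bar>Q z\<bar>) * (- \<gamma> / (2 * Q z))) 0 z"
    if "Q z \<noteq> 0" for z
  proof -
    have S: "has_grad (\<lambda>z. sqrt \<bar>Q z\<bar>) (sqrt \<bar>Q z\<bar> / (2 * Q z) * \<gamma>) (sqrt \<bar>Q z\<bar> / (2 * Q z) * 0) z"
      by (rule has_grad_real[where f = Q, OF has_real_derivative_sqrt_abs[OF that] QG])
    have eq: "- (s / (2 * Q z) * \<gamma>) / s\<^sup>2 = inverse s * (- \<gamma> / (2 * Q z))" if "s \<noteq> 0" for s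
      using that by (simp add: field_simps power2_eq_square)
    have s: "sqrt \<bar>Q z\<bar> \<noteq> 0" using that by simp
    show ?thesis by (rule has_grad_eq[OF has_grad_inverse[OF S s] eq[OF s]]) simp
  qed
  have BG: "has_grad B (B z * d z) (B z * b z) z" if "Q z \<noteq> 0" for z
    unfolding B_def
    by (rule has_grad_eq[OF has_grad_cmult[OF has_grad_mult[OF SG[OF that]
            has_grad_real[OF DERIV_exp has_grad_cmult[OF EG[OF that]]]]]])
      (auto simp: d_def algebra_simps)
  have "open ?U" unfolding Q_def by (intro open_Collect_neq continuous_intros)
  moreover have "continuous_on ?U (\<lambda>z. (T z, X z))"
    using CT[of 0] CX[of 0] by (auto intro: continuous_on_Pair)
  ultimately have "open (?U \<inter> (\<lambda>z. (T z, X z)) -` D)"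
    using f by (intro continuous_open_preimage) (auto simp: heat_on_def)
  moreover have E_eq: "?E = ?U \<inter> (\<lambda>z. (T z, X z)) -` D" by (auto simp: proj den)
  ultimately have "open ?E" by simp
  show ?thesis
    unfolding B
    by (rule heat_on_transform[OF f \<open>open ?E\<close> _ _ _ _ TG XG aG BG bG])
      (auto simp: proj den intro: C_on_subset[OF CT] C_on_subset[OF CX] C_on_subset[OF CB])
qed

text \<open>The exponents of two composed transformations add up to the exponent with coefficients
  \<open>l + a \<alpha>2 + b \<gamma>2\<close> and \<open>m + a \<beta>2 + b \<delta>2\<close> up to a constant, which is absorbed in \<open>\<sigma>\<close>.\<close>

definition coeffs_mult :: "coeffs \<Rightarrow> coeffs \<Rightarrow> coeffs" where
  "coeffs_mult = (\<lambda>(\<alpha>1, \<beta>1, \<gamma>1, \<delta>1, a, b, \<sigma>1) (\<alpha>2, \<beta>2, \<gamma>2, \<delta>2, l, m, \<sigma>2).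
     (\<alpha>1 * \<alpha>2 + \<beta>1 * \<gamma>2, \<alpha>1 * \<beta>2 + \<beta>1 * \<delta>2, \<gamma>1 * \<alpha>2 + \<delta>1 * \<gamma>2, \<gamma>1 * \<beta>2 + \<delta>1 * \<delta>2,
      l + a * \<alpha>2 + b * \<gamma>2, m + a * \<beta>2 + b * \<delta>2,
      \<sigma>1 * \<sigma>2 * exp (- (a * \<alpha>2 + b * \<gamma>2) * m / 2 - a\<^sup>2 * \<alpha>2 * \<beta>2 / 4 - a * b * \<beta>2 * \<gamma>2 / 2 - b\<^sup>2 * \<gamma>2 * \<delta>2 / 4)))"

lemma coeffs_mult_in: 
  assumes "c1 \<in> coeffs_space" "c2 \<in> coeffs_space"
  shows "coeffs_mult c1 c2 \<in> coeffs_space"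
proof (cases c1 rule: prod_cases7; cases c2 rule: prod_cases7)
  fix \<alpha>1 \<beta>1 \<gamma>1 \<delta>1 a b \<sigma>1 \<alpha>2 \<beta>2 \<gamma>2 \<delta>2 l m \<sigma>2
  assume [simp]: "c1 = (\<alpha>1, \<beta>1, \<gamma>1, \<delta>1, a, b, \<sigma>1)" "c2 = (\<alpha>2, \<beta>2, \<gamma>2, \<delta>2, l, m, \<sigma>2)"
  have "(\<alpha>1 * \<alpha>2 + \<beta>1 * \<gamma>2) * (\<gamma>1 * \<beta>2 + \<delta>1 * \<delta>2) - (\<alpha>1 * \<beta>2 + \<beta>1 * \<delta>2) * (\<gamma>1 * \<alpha>2 + \<delta>1 * \<gamma>2)
      = (\<alpha>1 * \<delta>1 - \<beta>1 * \<gamma>1) * (\<alpha>2 * \<delta>2 - \<beta>2 * \<gamma>2)"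
    by (simp add: algebra_simps)
  then show ?thesis using assms by (simp add: coeffs_space_def coeffs_mult_def)
qed

text \<open>The extra factor in the last entry of \<open>coeffs_mult\<close> is an exponential,
  hence positive.\<close>

lemma sgn_u_factor_mult: "sgn (u_factor (coeffs_mult c1 c2)) = sgn (u_factor c1) * sgn (u_factor c2)"
  by (cases c1; cases c2) (auto simp: u_factor_def coeffs_mult_def sgn_mult)

text \<open>The cocycle identity for denominators of fractional linear maps. Away from the singular
  line of \<open>c2\<close>, the product is singular exactly where \<open>proj c2\<close> hits the
  singular line of \<open>c1\<close>.\<close>

lemma den_mult:
  "den c2 (fst z) \<noteq> 0 \<Longrightarrow> den (coeffs_mult c1 c2) (fst z) = den c1 (fst (proj c2 z)) * den c2 (fst z)"
  by (cases c1; cases c2) (simp add: den_def coeffs_mult_def proj_def field_simps)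

lemma proj_mult:
  assumes "den c2 (fst z) \<noteq> 0" 
  shows "proj (coeffs_mult c1 c2) z = proj c1 (proj c2 z)"
proof (cases c1 rule: prod_cases7; cases c2 rule: prod_cases7)
  fix \<alpha>1 \<beta>1 \<gamma>1 \<delta>1 a b \<sigma>1 \<alpha>2 \<beta>2 \<gamma>2 \<delta>2 l m \<sigma>2
  assume c: "c1 = (\<alpha>1, \<beta>1, \<gamma>1, \<delta>1, a, b, \<sigma>1)" "c2 = (\<alpha>2, \<beta>2, \<gamma>2, \<delta>2, l, m, \<sigma>2)"
  obtain t x where z: "z = (t, x)" by (cases z)
  define q where "q = \<gamma>2 * t + \<delta>2"
  have q: "q \<noteq> 0" using assms by (simp add: den_def c z q_def)
  \<comment> \<open>Generic in both coefficients: it rewrites the numerator of the first component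
    as well as the common denominator.\<close>
  have 1: "\<gamma>1 * ((\<alpha>2 * t + \<beta>2) / q) + \<delta>1 = (\<gamma>1 * (\<alpha>2 * t + \<beta>2) + \<delta>1 * q) / q" for \<gamma>1 \<delta>1
    using q by (simp add: field_simps)
  have 2: "(x + l * t + m) / q + a * ((\<alpha>2 * t + \<beta>2) / q) + b =
      ((x + l * t + m) + a * (\<alpha>2 * t + \<beta>2) + b * q) / q"
    using q by (simp add: field_simps)
  have "proj c1 (proj c2 z) = ((\<alpha>1 * (\<alpha>2 * t + \<beta>2) + \<beta>1 * q) / (\<gamma>1 * (\<alpha>2 * t + \<beta>2) + \<delta>1 * q),
      ((x + l * t + m) + a * (\<alpha>2 * t + \<beta>2) + b * q) / (\<gamma>1 * (\<alpha>2 * t + \<beta>2) + \<delta>1 * q))"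
    unfolding c z proj_def prod.case fst_conv snd_conv q_def[symmetric] 1 2 using q by simp
  moreover have "proj (coeffs_mult c1 c2) z = ((\<alpha>1 * (\<alpha>2 * t + \<beta>2) + \<beta>1 * q) / (\<gamma>1 * (\<alpha>2 * t + \<beta>2) + \<delta>1 * q),
      ((x + l * t + m) + a * (\<alpha>2 * t + \<beta>2) + b * q) / (\<gamma>1 * (\<alpha>2 * t + \<beta>2) + \<delta>1 * q))"
    by (simp add: c z coeffs_mult_def proj_def q_def algebra_simps)
  ultimately show ?thesis by simp
qed

text \<open>The square roots multiply because the denominators do, so the work is in the exponents.
  Their sum has poles at \<open>q\<close> and \<open>Q\<close>; the pole at \<open>q\<close>
  cancels, the one at \<open>Q\<close> is that of the product, and the rest is polynomial.\<close>

lemma amp_mult: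
  assumes c2: "c2 \<in> coeffs_space" and "den c2 (fst z) \<noteq> 0" "den c1 (fst (proj c2 z)) \<noteq> 0"
  shows "amp (coeffs_mult c1 c2) z = amp c1 (proj c2 z) * amp c2 z"
proof (cases c1 rule: prod_cases7; cases c2 rule: prod_cases7)
  fix \<alpha>1 \<beta>1 \<gamma>1 \<delta>1 a b \<sigma>1 \<alpha>2 \<beta>2 \<gamma>2 \<delta>2 l m \<sigma>2
  assume c: "c1 = (\<alpha>1, \<beta>1, \<gamma>1, \<delta>1, a, b, \<sigma>1)" "c2 = (\<alpha>2, \<beta>2, \<gamma>2, \<delta>2, l, m, \<sigma>2)"
  obtain t x where z: "z = (t, x)" by (cases z)
  define q p y where "q = \<gamma>2 * t + \<delta>2" and "p = \<alpha>2 * t + \<beta>2" and "y = x + l * t + m"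
  define q1 Q Y where "q1 = \<gamma>1 * (p / q) + \<delta>1" and "Q = \<gamma>1 * p + \<delta>1 * q" and "Y = y + a * p + b * q"
  define K where "K = - (a * \<alpha>2 + b * \<gamma>2) * m / 2 - a\<^sup>2 * \<alpha>2 * \<beta>2 / 4 - a * b * \<beta>2 * \<gamma>2 / 2 - b\<^sup>2 * \<gamma>2 * \<delta>2 / 4"
  have det: "\<alpha>2 * \<delta>2 - \<beta>2 * \<gamma>2 = 1" using c2 by (simp add: coeffs_space_def c)
  have q: "q \<noteq> 0" "q1 \<noteq> 0" using assms by (simp_all add: den_def proj_def c z q_def p_def q1_def)
  have Q: "Q = q1 * q" using q by (simp add: Q_def q1_def field_simps)
  have Q_eq: "(\<gamma>1 * \<alpha>2 + \<delta>1 * \<gamma>2) * t + (\<gamma>1 * \<beta>2 + \<delta>1 * \<delta>2) = Q"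
    by (simp add: Q_def p_def q_def algebra_simps)
  have Y_eq: "x + (l + a * \<alpha>2 + b * \<gamma>2) * t + (m + a * \<beta>2 + b * \<delta>2) = Y"
    by (simp add: Y_def y_def p_def q_def algebra_simps)
  have y1: "y / q + a * (p / q) + b = Y / q" using q by (simp add: Y_def field_simps)
  have \<gamma>p: "\<gamma>2 * p = \<alpha>2 * q - 1" using det by (simp add: p_def q_def algebra_simps)
  \<comment> \<open>Writes \<gamma>1 as a combination of \<open>q\<close> and \<open>Q\<close>,
    which splits the quotient by \<open>Q * q\<close> in \<open>e1\<close> into partial
    fractions.\<close>
  have g1: "\<gamma>1 = (\<gamma>1 * \<alpha>2 + \<delta>1 * \<gamma>2) * q - \<gamma>2 * Q"
  proof -
    have "(\<gamma>1 * \<alpha>2 + \<delta>1 * \<gamma>2) * q - \<gamma>2 * Q = \<gamma>1 * (\<alpha>2 * q - \<gamma>2 * p)" by (simp add: Q_def algebra_simps)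
    with \<gamma>p show ?thesis by simp
  qed
  have "\<gamma>1 * (Y / q)\<^sup>2 / (4 * q1) = \<gamma>1 * Y\<^sup>2 / (4 * Q * q)"
    using q by (simp add: Q field_simps power2_eq_square)
  also have "\<dots> = ((\<gamma>1 * \<alpha>2 + \<delta>1 * \<gamma>2) * q - \<gamma>2 * Q) * Y\<^sup>2 / (4 * Q * q)"
    using g1 by simp
  also have "\<dots> = (\<gamma>1 * \<alpha>2 + \<delta>1 * \<gamma>2) * Y\<^sup>2 / (4 * Q) - \<gamma>2 * Y\<^sup>2 / (4 * q)"
    using q by (simp add: Q field_simps)
  finally have e1: "\<gamma>1 * (Y / q)\<^sup>2 / (4 * q1) = (\<gamma>1 * \<alpha>2 + \<delta>1 * \<gamma>2) * Y\<^sup>2 / (4 * Q) - \<gamma>2 * Y\<^sup>2 / (4 * q)" .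
  \<comment> \<open>All terms with denominator \<open>q\<close> are collected. Replacing
    \<open>\<gamma>2 * p + 1\<close> by \<open>\<alpha>2 * q\<close>, that is, using the
    determinant, makes the numerator divisible by \<open>q\<close>.\<close>
  have e2: "- \<gamma>2 * Y\<^sup>2 / (4 * q) - a / 2 * (y / q) - a\<^sup>2 / 4 * (p / q) + \<gamma>2 * y\<^sup>2 / (4 * q)
      = - y * a * \<alpha>2 / 2 - \<gamma>2 * b * y / 2 - a\<^sup>2 * p * \<alpha>2 / 4 - \<gamma>2 * a * b * p / 2 - \<gamma>2 * b\<^sup>2 * q / 4"
  proof -
    have "- \<gamma>2 * Y\<^sup>2 - 2 * a * y - a\<^sup>2 * p + \<gamma>2 * y\<^sup>2
        = - (2 * y * a + a\<^sup>2 * p) * (\<gamma>2 * p + 1) - (2 * \<gamma>2 * b * y + 2 * \<gamma>2 * a * b * p + \<gamma>2 * b\<^sup>2 * q) * q"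
      by (simp add: Y_def algebra_simps power2_eq_square)
    also have "\<dots> = - (2 * y * a + a\<^sup>2 * p) * (\<alpha>2 * q) - (2 * \<gamma>2 * b * y + 2 * \<gamma>2 * a * b * p + \<gamma>2 * b\<^sup>2 * q) * q"
      using \<gamma>p by simp
    finally have *: "(- \<gamma>2 * Y\<^sup>2 - 2 * a * y - a\<^sup>2 * p + \<gamma>2 * y\<^sup>2) / (4 * q) =
        (- (2 * y * a + a\<^sup>2 * p) * (\<alpha>2 * q) - (2 * \<gamma>2 * b * y + 2 * \<gamma>2 * a * b * p + \<gamma>2 * b\<^sup>2 * q) * q) / (4 * q)"
      by simp
    have "- \<gamma>2 * Y\<^sup>2 / (4 * q) - a / 2 * (y / q) - a\<^sup>2 / 4 * (p / q) + \<gamma>2 * y\<^sup>2 / (4 * q)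
        = (- \<gamma>2 * Y\<^sup>2 - 2 * a * y - a\<^sup>2 * p + \<gamma>2 * y\<^sup>2) / (4 * q)"
      using q by (simp add: field_simps)
    also have "\<dots> = - y * a * \<alpha>2 / 2 - \<gamma>2 * b * y / 2 - a\<^sup>2 * p * \<alpha>2 / 4 - \<gamma>2 * a * b * p / 2 - \<gamma>2 * b\<^sup>2 * q / 4"
      unfolding * using q by (simp add: field_simps)
    finally show ?thesis .
  qed
  \<comment> \<open>A comparison of polynomials in t and x. The leftover constant \<open>K\<close>
    is the exponent in the last entry of \<open>coeffs_mult\<close>.\<close>
  have e3: "- y * a * \<alpha>2 / 2 - \<gamma>2 * b * y / 2 - a\<^sup>2 * p * \<alpha>2 / 4 - \<gamma>2 * a * b * p / 2 - \<gamma>2 * b\<^sup>2 * q / 4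
      - l / 2 * x - l\<^sup>2 / 4 * t = K - (l + a * \<alpha>2 + b * \<gamma>2) / 2 * x - (l + a * \<alpha>2 + b * \<gamma>2)\<^sup>2 / 4 * t"
    by (simp add: K_def y_def p_def q_def field_simps power2_eq_square)
  have "K + ((\<gamma>1 * \<alpha>2 + \<delta>1 * \<gamma>2) * Y\<^sup>2 / (4 * Q) - (l + a * \<alpha>2 + b * \<gamma>2) / 2 * x - (l + a * \<alpha>2 + b * \<gamma>2)\<^sup>2 / 4 * t)
     = (\<gamma>1 * (Y / q)\<^sup>2 / (4 * q1) - a / 2 * (y / q) - a\<^sup>2 / 4 * (p / q)) + (\<gamma>2 * y\<^sup>2 / (4 * q) - l / 2 * x - l\<^sup>2 / 4 * t)"
    using e1 e2 e3 by simp
  then have "exp K * exp ((\<gamma>1 * \<alpha>2 + \<delta>1 * \<gamma>2) * Y\<^sup>2 / (4 * Q) - (l + a * \<alpha>2 + b * \<gamma>2) / 2 * x - (l + a * \<alpha>2 + b * \<gamma>2)\<^sup>2 / 4 * t)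
     = exp (\<gamma>1 * (Y / q)\<^sup>2 / (4 * q1) - a / 2 * (y / q) - a\<^sup>2 / 4 * (p / q)) * exp (\<gamma>2 * y\<^sup>2 / (4 * q) - l / 2 * x - l\<^sup>2 / 4 * t)"
    by (simp only: exp_add[symmetric])
  moreover have "sqrt \<bar>Q\<bar> = sqrt \<bar>q1\<bar> * sqrt \<bar>q\<bar>" by (simp add: Q abs_mult real_sqrt_mult)
  moreover have "amp (coeffs_mult c1 c2) z = \<sigma>1 * \<sigma>2 * exp K * sqrt \<bar>Q\<bar> *
      exp ((\<gamma>1 * \<alpha>2 + \<delta>1 * \<gamma>2) * Y\<^sup>2 / (4 * Q) - (l + a * \<alpha>2 + b * \<gamma>2) / 2 * x - (l + a * \<alpha>2 + b * \<gamma>2)\<^sup>2 / 4 * t)"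
    by (simp only: c z amp_def coeffs_mult_def prod.case fst_conv snd_conv Q_eq Y_eq K_def)
  moreover have "amp c1 (proj c2 z) = \<sigma>1 * sqrt \<bar>q1\<bar> * exp (\<gamma>1 * (Y / q)\<^sup>2 / (4 * q1) - a / 2 * (y / q) - a\<^sup>2 / 4 * (p / q))"
    by (simp only: c z amp_def proj_def prod.case fst_conv snd_conv q_def[symmetric] p_def[symmetric]
      y_def[symmetric] q1_def[symmetric] y1)
  moreover have "amp c2 z = \<sigma>2 * sqrt \<bar>q\<bar> * exp (\<gamma>2 * y\<^sup>2 / (4 * q) - l / 2 * x - l\<^sup>2 / 4 * t)"
    by (simp add: c z amp_def q_def y_def)
  ultimately show ?thesis by (simp add: mult.assoc mult.left_commute)
qed

section \<open>Regular points and the recovery of the coefficients\<close>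

lemma heat_GI: "c \<in> coeffs_space \<Longrightarrow> local_solution h \<Longrightarrow> Phi c h \<in> heat_G"
  unfolding heat_G_def by blast

text \<open>By the determinant condition \<open>den c\<close> is not identically zero. Singular
  lines are of the form t = const, so every limit below is taken in t with x fixed.\<close>

lemma eventually_den_nonzero:
  assumes "c \<in> coeffs_space"
  shows "\<forall>\<^sub>F s in at t. den c s \<noteq> 0"
proof -
  obtain \<alpha> \<beta> \<gamma> \<delta> l m \<sigma> where c: "c = (\<alpha>, \<beta>, \<gamma>, \<delta>, l, m, \<sigma>)" by (metis prod_cases7)
  show ?thesis
  proof (cases "\<gamma> = 0")
    case True
    then have "\<delta> \<noteq> 0" using assms by (auto simp: c coeffs_space_def)
    then show ?thesis by (simp add: den_def c True)
  next
    case False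
    have "\<forall>\<^sub>F s in at t. s \<noteq> - \<delta> / \<gamma>" by (rule eventually_neq_at_within)
    then show ?thesis
      by eventually_elim (use False in \<open>auto simp: den_def c field_simps add_eq_0_iff\<close>)
  qed
qed

lemma eventually_dom:
  assumes "local_solution h" "(t, x) \<in> dom h"
  shows "\<forall>\<^sub>F s in at t. (s, x) \<in> dom h"
proof -
  have "open ((\<lambda>s. (s, x)) -` dom h)"
    using assms(1) by (intro open_vimage continuous_intros) (simp add: local_solution_def)
  then have "\<forall>\<^sub>F s in at t. s \<in> (\<lambda>s. (s, x)) -` dom h"
    using assms(2) by (intro eventually_at_in_open') auto
  then show ?thesis by simp
qed

lemma open_regular_dom:
  assumes "local_solution h"
  shows "open {z \<in> dom h. den c (fst z) \<noteq> 0}"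
proof -
  have "open {z :: real \<times> real. den c (fst z) \<noteq> 0}"
    unfolding den_def by (cases c) (auto intro!: open_Collect_neq continuous_intros)
  moreover have "{z \<in> dom h. den c (fst z) \<noteq> 0} = dom h \<inter> {z. den c (fst z) \<noteq> 0}" by auto
  ultimately show ?thesis using assms by (auto simp: local_solution_def)
qed

lemma regular_dom_nonempty:
  assumes "local_solution h" "c \<in> coeffs_space"
  obtains t x where "(t, x) \<in> dom h" "den c t \<noteq> 0"
proof -
  obtain z where "z \<in> dom h" using assms(1) unfolding local_solution_def by blast
  then obtain t x where "(t, x) \<in> dom h" by (cases z) blast
  then have "\<forall>\<^sub>F s in at t. (s, x) \<in> dom h \<and> den c s \<noteq> 0"
    by (intro eventually_conj eventually_dom eventually_den_nonzero assms)
  from eventually_happens'[OF at_neq_bot this] obtain s where "(s, x) \<in> dom h \<and> den c s \<noteq> 0"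
    by blast
  then show ?thesis using that by blast
qed

lemma affine_eqD:
  fixes a b :: real
  assumes "a * t + b = a' * t + b'" "a * (t + e) + b = a' * (t + e) + b'" "e \<noteq> 0"
  shows "a = a' \<and> b = b'"
proof -
  have "a * e = (a * (t + e) + b) - (a * t + b)" by (simp add: algebra_simps)
  also have "\<dots> = a' * e" unfolding assms(1,2) by (simp add: algebra_simps)
  finally have "a = a'" using assms(3) by simp
  then show ?thesis using assms by simp
qed

text \<open>A small rectangle of regular points suffices: two values of u give the slope, two of x
  give the denominator, two of t give the affine functions, and then the slope gives \<sigma>.
  Having extension instead of equality as hypothesis fixes the coefficients of every candidate for
  \<open>mcomp\<close>.\<close>

lemma Phi_le_imp_coeffs_eq:
  assumes c: "c \<in> coeffs_space" "c' \<in> coeffs_space" and h: "local_solution h"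
    and le: "Phi c h \<subseteq>\<^sub>m Phi c' h'"
  shows "c = c'"
proof -
  let ?D = "{z \<in> dom h. den c (fst z) \<noteq> 0}"
  obtain t x where "(t, x) \<in> dom h" "den c t \<noteq> 0" using regular_dom_nonempty[OF h c(1)] by blast
  then have tx: "(t, x) \<in> ?D" by simp
  obtain A B where AB: "open A" "open B" "t \<in> A" "x \<in> B" "A \<times> B \<subseteq> ?D"
    by (rule open_prod_elim[OF open_regular_dom[OF h, of c] tx]) blast
  obtain e1 where e1: "e1 > 0" "ball t e1 \<subseteq> A" using AB open_contains_ball by blast
  obtain e2 where e2: "e2 > 0" "ball x e2 \<subseteq> B" using AB open_contains_ball by blast
  define e where "e = min e1 e2 / 2"
  have e: "e > 0" using e1 e2 by (simp add: e_def)
  have A: "t + e \<in> A" using e1 e2 by (auto intro!: subsetD[OF e1(2)] simp: e_def dist_real_def)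
  have B: "x + e \<in> B" using e1 e2 by (auto intro!: subsetD[OF e2(2)] simp: e_def dist_real_def)
  have eq: "den c s \<noteq> 0 \<and> den c' s \<noteq> 0 \<and> proj c (s, y) = proj c' (s, y) \<and> amp c (s, y) = amp c' (s, y)"
    if "s \<in> A" "y \<in> B" for s y
  proof -
    have sy: "(s, y) \<in> dom h" "den c s \<noteq> 0" using that AB(5) by auto
    then have *: "Phi c' h' (s, y, u) = Phi c h (s, y, u)" for u
      using le by (auto simp: map_le_def Phi_eq dom_def)
    have "den c' s \<noteq> 0" "(s, y) \<in> dom h'" using *[of 0] sy by (auto simp: Phi_eq split: if_splits)
    then have "proj c (s, y) = proj c' (s, y)"
      "amp c' (s, y) * (u + the (h' (s, y))) = amp c (s, y) * (u + the (h (s, y)))" for u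
      using *[of u] sy by (auto simp: Phi_eq prod_eq_iff)
    \<comment> \<open>The values u = 0 and u = 1 separate the slope from the parameter
      function.\<close>
    from this(1) this(2)[of 0] this(2)[of 1] show ?thesis
      using sy \<open>den c' s \<noteq> 0\<close> by (simp add: algebra_simps)
  qed
  obtain \<alpha> \<beta> \<gamma> \<delta> l m \<sigma> where c_eq: "c = (\<alpha>, \<beta>, \<gamma>, \<delta>, l, m, \<sigma>)" by (metis prod_cases7)
  obtain \<alpha>' \<beta>' \<gamma>' \<delta>' l' m' \<sigma>' where c'_eq: "c' = (\<alpha>', \<beta>', \<gamma>', \<delta>', l', m', \<sigma>')" by (metis prod_cases7)
  have *: "\<gamma> * s + \<delta> = \<gamma>' * s + \<delta>' \<and> \<alpha> * s + \<beta> = \<alpha>' * s + \<beta>' \<and> l * s + m = l' * s + m'" if s: "s \<in> A" for s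
  proof -
    define q q' where "q = \<gamma> * s + \<delta>" and "q' = \<gamma>' * s + \<delta>'"
    have q: "q \<noteq> 0" "q' \<noteq> 0" "(\<alpha> * s + \<beta>) / q = (\<alpha>' * s + \<beta>') / q'"
      "(x + l * s + m) / q = (x + l' * s + m') / q'"
      "(x + e + l * s + m) / q = (x + e + l' * s + m') / q'"
      using eq[OF s AB(4)] eq[OF s B] by (simp_all add: den_def proj_def c_eq c'_eq q_def q'_def)
    \<comment> \<open>The increment in x isolates the reciprocal of the denominator. The t-component
      alone would determine the matrix only up to sign.\<close>
    have "e / q = (x + e + l * s + m) / q - (x + l * s + m) / q" by (simp add: diff_divide_distrib[symmetric])
    also have "\<dots> = (x + e + l' * s + m') / q' - (x + l' * s + m') / q'" by (simp add: q)
    also have "\<dots> = e / q'" by (simp add: diff_divide_distrib[symmetric])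
    finally have "q = q'" using q e by (simp add: field_simps)
    with q show ?thesis unfolding q_def[symmetric] q'_def[symmetric] by simp
  qed
  have "\<gamma> = \<gamma>' \<and> \<delta> = \<delta>'" "\<alpha> = \<alpha>' \<and> \<beta> = \<beta>'" "l = l' \<and> m = m'"
    using affine_eqD[of _ t _ _ _ e] *[OF AB(3)] *[OF A] e by blast+
  moreover from this have "\<sigma> = \<sigma>'"
    using eq[OF AB(3,4)] by (auto simp: amp_def den_def c_eq c'_eq)
  ultimately show ?thesis by (simp add: c_eq c'_eq)
qed

lemma Phi_eq_imp_coeffs_eq:
  "c \<in> coeffs_space \<Longrightarrow> c' \<in> coeffs_space \<Longrightarrow> local_solution h \<Longrightarrow> Phi c h = Phi c' h' \<Longrightarrow> c = c'"
  using Phi_le_imp_coeffs_eq map_le_refl by metis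

text \<open>\<open>singular_times\<close> quantifies over all representations of the transformation;
  uniqueness of coefficients reduces it to the given one.\<close>

lemma singular_times_Phi:
  assumes "c \<in> coeffs_space" "local_solution h"
  shows "singular_times (Phi c h) = {t. den c t = 0}"
proof -
  have "den c t = 0" if "(\<alpha>, \<beta>, \<gamma>, \<delta>, l, m, \<sigma>) \<in> coeffs_space" "local_solution h'"
    "Phi c h = Phi (\<alpha>, \<beta>, \<gamma>, \<delta>, l, m, \<sigma>) h'" "\<gamma> * t + \<delta> = 0" for \<alpha> \<beta> \<gamma> \<delta> l m \<sigma> h' t
    using Phi_eq_imp_coeffs_eq[OF assms(1) that(1) assms(2) that(3)] that(4) by (simp add: den_def)
  moreover have "t \<in> singular_times (Phi c h)" if "den c t = 0" for t
  proof -
    obtain \<alpha> \<beta> \<gamma> \<delta> l m \<sigma> where c: "c = (\<alpha>, \<beta>, \<gamma>, \<delta>, l, m, \<sigma>)" by (metis prod_cases7)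
    have "\<gamma> * t + \<delta> = 0" using that by (simp add: den_def c)
    then show ?thesis using assms unfolding singular_times_def c by blast
  qed
  ultimately show ?thesis unfolding singular_times_def by blast
qed

section \<open>Composition and modified composition\<close>

definition comp_solution :: "coeffs \<Rightarrow> (real \<times> real \<rightharpoonup> real) \<Rightarrow> (real \<times> real \<rightharpoonup> real) \<Rightarrow> (real \<times> real \<rightharpoonup> real)" where
  "comp_solution c h1 h2 = (\<lambda>z. if z \<in> dom h2 \<and> den c (fst z) \<noteq> 0 \<and> proj c z \<in> dom h1
     then Some (the (h2 z) + the (h1 (proj c z)) / amp c z) else None)"

lemma dom_comp_solution:
  "dom (comp_solution c h1 h2) = {z \<in> dom h2. den c (fst z) \<noteq> 0 \<and> proj c z \<in> dom h1}"
  unfolding comp_solution_def dom_if by auto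

lemma local_solution_comp:
  assumes "c \<in> coeffs_space" "local_solution h1" "local_solution h2" "dom (comp_solution c h1 h2) \<noteq> {}"
  shows "local_solution (comp_solution c h1 h2)"
proof -
  let ?E = "{z. den c (fst z) \<noteq> 0 \<and> proj c z \<in> dom h1}"
  have "heat_on (the \<circ> h1) (dom h1)" using assms by (simp add: local_solution_iff)
  then have 1: "heat_on (\<lambda>z. (the \<circ> h1) (proj c z) / amp c z) ?E" by (rule heat_on_pullback[OF assms(1)])
  have 2: "heat_on (the \<circ> h2) (dom h2)" using assms by (simp add: local_solution_iff)
  have D: "dom (comp_solution c h1 h2) = dom h2 \<inter> ?E" by (auto simp: dom_comp_solution)
  have "open (dom h2 \<inter> ?E)" using 1 2 by (auto simp: heat_on_def)
  then have "heat_on (\<lambda>z. (the \<circ> h2) z + (the \<circ> h1) (proj c z) / amp c z) (dom h2 \<inter> ?E)"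
    by (intro heat_on_add heat_on_subset[OF 1] heat_on_subset[OF 2]) auto
  then have "heat_on (the \<circ> comp_solution c h1 h2) (dom (comp_solution c h1 h2))"
    unfolding D by (rule heat_on_cong) (auto simp: comp_solution_def)
  then show ?thesis using assms(4) by (simp add: local_solution_iff)
qed

text \<open>Factoring \<open>amp c2\<close> out of amp c2 (u + h2) + h1 gives the formula in
  \<open>comp_solution\<close>. That function is cut along the singular line of \<open>c2\<close>;
  the singular line of \<open>c1\<close> is excluded by \<open>Phi\<close> itself through
  \<open>den_mult\<close>.\<close>

lemma map_comp_Phi:
  assumes "c2 \<in> coeffs_space"
  shows "Phi c1 h1 \<circ>\<^sub>m Phi c2 h2 = Phi (coeffs_mult c1 c2) (comp_solution c2 h1 h2)"
proof
  fix p :: "real \<times> real \<times> real"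
  obtain t x u where p: "p = (t, x, u)" by (metis prod_cases3)
  show "(Phi c1 h1 \<circ>\<^sub>m Phi c2 h2) p = Phi (coeffs_mult c1 c2) (comp_solution c2 h1 h2) p"
  proof (cases "(t, x) \<in> dom (comp_solution c2 h1 h2) \<and> den c1 (fst (proj c2 (t, x))) \<noteq> 0")
    case True
    then have d: "(t, x) \<in> dom h2" "den c2 t \<noteq> 0" "proj c2 (t, x) \<in> dom h1" "den c1 (fst (proj c2 (t, x))) \<noteq> 0"
      by (auto simp: dom_comp_solution)
    have "amp c2 (t, x) \<noteq> 0" using amp_nonzero[OF assms, of "(t, x)"] d by simp
    then show ?thesis
      using d den_mult[of c2 "(t, x)" c1] proj_mult[of c2 "(t, x)" c1] amp_mult[OF assms, of "(t, x)" c1]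
      by (auto simp: p map_comp_def Phi_eq comp_solution_def domIff algebra_simps)
  next
    case False
    then show ?thesis
      using den_mult[of c2 "(t, x)" c1]
      by (auto simp: p map_comp_def Phi_eq dom_comp_solution split: option.splits if_splits)
  qed
qed

lemma dom_Phi: "dom (Phi c h) = {(t, x, u). (t, x) \<in> dom h \<and> den c t \<noteq> 0}"
  by (auto simp: dom_def Phi_eq split: if_splits)

lemma composable_imp_dom:
  "c2 \<in> coeffs_space \<Longrightarrow> composable (Phi c1 h1) (Phi c2 h2) \<Longrightarrow> dom (comp_solution c2 h1 h2) \<noteq> {}"
  unfolding composable_def map_comp_Phi dom_Phi by auto

lemma mcomp_eqI:
  assumes "\<Phi> \<in> comp_extensions \<Phi>1 \<Phi>2" "\<And>\<Psi>. \<Psi> \<in> comp_extensions \<Phi>1 \<Phi>2 \<Longrightarrow> \<Psi> \<subseteq>\<^sub>m \<Phi>"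
  shows "mcomp \<Phi>1 \<Phi>2 = \<Phi>"
  unfolding mcomp_def using assms by (intro the_equality) (auto intro: map_le_antisym)

lemma local_solution_tendsto:
  assumes "local_solution h" "(t, x) \<in> dom h"
  shows "((\<lambda>s. the (h (s, x))) \<longlongrightarrow> the (h (t, x))) (at t)"
proof -
  have "continuous_on (dom h) (the \<circ> h)" "open (dom h)"
    using assms(1) unfolding local_solution_def by (auto dest: spec[of _ 0])
  then have "isCont (the \<circ> h) (t, x)" using assms(2) continuous_on_eq_continuous_at by blast
  moreover have "isCont (\<lambda>s. (s, x)) t" by (intro continuous_intros)
  ultimately have "isCont (\<lambda>s. (the \<circ> h) (s, x)) t" by (rule isCont_o2[rotated])
  then show ?thesis by (simp add: isCont_def)
qed

text \<open>Any two extensions agree with \<open>\<Phi>\<^sub>1 \<circ>\<^sub>m \<Phi>\<^sub>2\<close> off two lines \<open>t = const\<close>, hence, by continuity, with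
  each other, so that their parameter functions have a common extension.\<close>

lemma mcomp_Phi:
  assumes c: "c1 \<in> coeffs_space" "c2 \<in> coeffs_space" and h: "local_solution h1" "local_solution h2"
    and dom: "dom (comp_solution c2 h1 h2) \<noteq> {}"
  obtains h where "local_solution h" "mcomp (Phi c1 h1) (Phi c2 h2) = Phi (coeffs_mult c1 c2) h"
proof -
  define c where "c = coeffs_mult c1 c2"
  define h0 where "h0 = comp_solution c2 h1 h2"
  have comp: "Phi c1 h1 \<circ>\<^sub>m Phi c2 h2 = Phi c h0" using map_comp_Phi c by (simp add: c_def h0_def)
  have c_in: "c \<in> coeffs_space" using coeffs_mult_in c by (simp add: c_def)
  have h0: "local_solution h0" using local_solution_comp c h dom by (simp add: h0_def)
  \<comment> \<open>Fixing the coefficients \<open>c\<close> loses no extension, by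
    \<open>Phi_le_imp_coeffs_eq\<close>.\<close>
  define \<H> where "\<H> = {h. local_solution h \<and> Phi c h \<in> comp_extensions (Phi c1 h1) (Phi c2 h2)}"
  have ext_iff: "Phi c h \<in> comp_extensions (Phi c1 h1) (Phi c2 h2) \<longleftrightarrow> Phi c h0 \<subseteq>\<^sub>m Phi c h \<and>
      (\<forall>(t, x, u) \<in> dom (Phi c h) - dom (Phi c h0). den c2 t = 0)" if "local_solution h" for h
    using c_in that by (auto simp: comp_extensions_def comp singular_times_Phi[OF c(2) h(2)] heat_GI)
  \<comment> \<open>The two exceptional lines: on one \<open>Phi c\<close> is undefined, on the
    other points may have been added.\<close>
  have agree0: "h' (s, x) = h0 (s, x)" if "h' \<in> \<H>" "(s, x) \<in> dom h'" "den c s \<noteq> 0" "den c2 s \<noteq> 0" for h' s x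
  proof -
    have "(s, x, 0) \<in> dom (Phi c h')" using that by (simp add: dom_Phi domIff)
    moreover have "\<forall>(t, x, u) \<in> dom (Phi c h') - dom (Phi c h0). den c2 t = 0"
      using that(1) ext_iff unfolding \<H>_def by blast
    ultimately have "(s, x, 0) \<in> dom (Phi c h0)" using that(4) by blast
    then have "(s, x) \<in> dom h0" by (simp add: dom_Phi domIff)
    moreover have "Phi c h0 \<subseteq>\<^sub>m Phi c h'" using that(1) ext_iff unfolding \<H>_def by blast
    then have "Phi c h0 (s, x, 0) = Phi c h' (s, x, 0)"
      using \<open>(s, x, 0) \<in> dom (Phi c h0)\<close> by (simp add: map_le_def)
    ultimately show ?thesis
      using that amp_nonzero[OF c_in, of "(s, x)"] by (auto simp: Phi_eq)
  qed
  have agree: "h' z = h'' z" if h': "h' \<in> \<H>" "h'' \<in> \<H>" "z \<in> dom h'" "z \<in> dom h''" for h' h'' z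
  proof -
    obtain t x where z: "z = (t, x)" by (cases z)
    have sol: "local_solution h'" "local_solution h''" using h' by (auto simp: \<H>_def)
    have "\<forall>\<^sub>F s in at t. ((s, x) \<in> dom h' \<and> (s, x) \<in> dom h'') \<and> den c s \<noteq> 0 \<and> den c2 s \<noteq> 0"
      using h' sol c_in c by (intro eventually_conj eventually_dom eventually_den_nonzero) (auto simp: z)
    then have "\<forall>\<^sub>F s in at t. the (h' (s, x)) = the (h'' (s, x))"
      by eventually_elim (metis agree0 h'(1,2))
    then have "((\<lambda>s. the (h'' (s, x))) \<longlongrightarrow> the (h' z)) (at t)"
      unfolding z by (rule Lim_transform_eventually[OF local_solution_tendsto[OF sol(1) h'(3)[unfolded z]]])
    moreover have "((\<lambda>s. the (h'' (s, x))) \<longlongrightarrow> the (h'' z)) (at t)"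
      using local_solution_tendsto[OF sol(2) h'(4)[unfolded z]] by (simp add: z)
    ultimately have "the (h' z) = the (h'' z)" by (rule tendsto_unique[OF at_neq_bot])
    then show ?thesis using h' by auto
  qed
  define hU where "hU z = (if \<exists>h\<in>\<H>. z \<in> dom h then (SOME h. h \<in> \<H> \<and> z \<in> dom h) z else None)" for z
  have hU: "hU z = h' z" if "h' \<in> \<H>" "z \<in> dom h'" for h' z
  proof -
    have "(SOME h. h \<in> \<H> \<and> z \<in> dom h) \<in> \<H> \<and> z \<in> dom (SOME h. h \<in> \<H> \<and> z \<in> dom h)"
      using someI[of "\<lambda>h. h \<in> \<H> \<and> z \<in> dom h" h'] that by blast
    then have "(SOME h. h \<in> \<H> \<and> z \<in> dom h) z = h' z" using agree that by blast
    then show ?thesis using that by (auto simp: hU_def)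
  qed
  have dom_hU: "dom hU = \<Union>(dom ` \<H>)"
    using hU by (force simp: hU_def domIff split: if_splits)
  have h0_in: "h0 \<in> \<H>" using h0 by (auto simp: \<H>_def ext_iff)
  have "heat_on (the \<circ> hU) (dom h')" if "h' \<in> \<H>" for h'
  proof (rule heat_on_cong)
    show "heat_on (the \<circ> h') (dom h')" using that by (simp add: \<H>_def local_solution_iff)
  qed (simp add: hU[OF that])
  then have "heat_on (the \<circ> hU) (dom hU)" unfolding dom_hU by (intro heat_on_Union) auto
  moreover have "dom hU \<noteq> {}" using h0_in h0 dom_hU by (auto simp: local_solution_iff)
  ultimately have U_sol: "local_solution hU" by (simp add: local_solution_iff)
  have le: "Phi c h' \<subseteq>\<^sub>m Phi c hU" if "h' \<in> \<H>" for h'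
  proof -
    have "Phi c h' (t, x, u) = Phi c hU (t, x, u)" if "(t, x) \<in> dom h'" for t x u
      using that hU[OF \<open>h' \<in> \<H>\<close> that] by (auto simp: Phi_eq domIff)
    then show ?thesis by (auto simp: map_le_def dom_Phi)
  qed
  have "mcomp (Phi c1 h1) (Phi c2 h2) = Phi c hU"
  proof (rule mcomp_eqI)
    show "Phi c hU \<in> comp_extensions (Phi c1 h1) (Phi c2 h2)"
      unfolding ext_iff[OF U_sol]
    proof (intro conjI le h0_in ballI)
      fix p assume p: "p \<in> dom (Phi c hU) - dom (Phi c h0)"
      obtain t x u where p_eq: "p = (t, x, u)" by (metis prod_cases3)
      obtain h' where "h' \<in> \<H>" "(t, x) \<in> dom h'" using p dom_hU by (auto simp: p_eq dom_Phi)
      then have "p \<in> dom (Phi c h') - dom (Phi c h0)" using p by (auto simp: p_eq dom_Phi)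
      then show "case p of (t, x, u) \<Rightarrow> den c2 t = 0"
        using \<open>h' \<in> \<H>\<close> ext_iff unfolding \<H>_def by blast
    qed
    show "\<Psi> \<subseteq>\<^sub>m Phi c hU" if \<Psi>: "\<Psi> \<in> comp_extensions (Phi c1 h1) (Phi c2 h2)" for \<Psi>
    proof -
      obtain c' h' where 1: "\<Psi> = Phi c' h'" "c' \<in> coeffs_space" "local_solution h'"
        using \<Psi> unfolding comp_extensions_def heat_G_def by blast
      have "Phi c h0 \<subseteq>\<^sub>m Phi c' h'" using \<Psi> by (simp add: comp_extensions_def comp 1)
      then have "c = c'" using Phi_le_imp_coeffs_eq c_in 1 h0 by blast
      then show ?thesis using le \<Psi> 1 by (auto simp: \<H>_def)
    qed
  qed
  with U_sol that show ?thesis by (simp add: c_def)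
qed

text \<open>If the singular line of the second factor is singular for the product too, no element
  with the product's coefficients can add points there.\<close>

lemma mcomp_Phi_eq_map_comp:
  assumes c: "c1 \<in> coeffs_space" "c2 \<in> coeffs_space" and h: "local_solution h1" "local_solution h2"
    and dom: "dom (comp_solution c2 h1 h2) \<noteq> {}"
    and sing: "\<And>t. den c2 t = 0 \<Longrightarrow> den (coeffs_mult c1 c2) t = 0"
  shows "mcomp (Phi c1 h1) (Phi c2 h2) = Phi c1 h1 \<circ>\<^sub>m Phi c2 h2"
proof -
  define c where "c = coeffs_mult c1 c2"
  define h0 where "h0 = comp_solution c2 h1 h2"
  have comp: "Phi c1 h1 \<circ>\<^sub>m Phi c2 h2 = Phi c h0" using map_comp_Phi c by (simp add: c_def h0_def)
  have c_in: "c \<in> coeffs_space" using coeffs_mult_in c by (simp add: c_def)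
  have h0: "local_solution h0" using local_solution_comp c h dom by (simp add: h0_def)
  show ?thesis
  proof (rule mcomp_eqI)
    show "Phi c1 h1 \<circ>\<^sub>m Phi c2 h2 \<in> comp_extensions (Phi c1 h1) (Phi c2 h2)"
      using c_in h0 by (auto simp: comp_extensions_def comp heat_GI)
    fix \<Psi> assume \<Psi>: "\<Psi> \<in> comp_extensions (Phi c1 h1) (Phi c2 h2)"
    obtain c' h' where 1: "\<Psi> = Phi c' h'" "c' \<in> coeffs_space" "local_solution h'"
      using \<Psi> unfolding comp_extensions_def heat_G_def by blast
    have le: "Phi c h0 \<subseteq>\<^sub>m \<Psi>" using \<Psi> by (simp add: comp_extensions_def comp)
    then have "c = c'" using Phi_le_imp_coeffs_eq c_in 1 h0 by blast
    have "p \<in> dom (Phi c h0)" if p: "p \<in> dom \<Psi>" for p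
    proof (rule ccontr)
      assume np: "p \<notin> dom (Phi c h0)"
      obtain t x u where p_eq: "p = (t, x, u)" by (metis prod_cases3)
      have "den c2 t = 0"
        using \<Psi> p np by (auto simp: comp_extensions_def comp singular_times_Phi[OF c(2) h(2)] p_eq)
      then have "den c t = 0" using sing by (simp add: c_def)
      with p show False by (auto simp: 1 \<open>c = c'\<close> p_eq dom_Phi)
    qed
    then show "\<Psi> \<subseteq>\<^sub>m Phi c1 h1 \<circ>\<^sub>m Phi c2 h2"
      using le unfolding comp map_le_def by metis
  qed
qed

section \<open>The identity component and the factor group\<close>

definition scal :: "real \<Rightarrow> coeffs" where
  "scal s = (1, 0, 0, 1, 0, 0, s)"

lemma scal_in: "scal s \<in> coeffs_space \<longleftrightarrow> s \<noteq> 0"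
  by (simp add: scal_def coeffs_space_def)

lemma u_factor_scal: "u_factor (scal s) = s"
  by (simp add: scal_def u_factor_def)

lemma den_scal: "den (scal s) t = 1"
  by (simp add: scal_def den_def)

lemma proj_scal: "proj (scal s) z = z"
  by (simp add: scal_def proj_def)

lemma amp_scal: "amp (scal s) z = s"
  by (simp add: scal_def amp_def)

lemma scal_mult_scal: "coeffs_mult (scal r) (scal s) = scal (r * s)"
  by (simp add: scal_def coeffs_mult_def)

lemma den_scal_mult: "den (coeffs_mult (scal s) c) = den c"
  by (cases c) (simp add: scal_def coeffs_mult_def den_def)

lemma scal_mult_scal_mult: "coeffs_mult (scal r) (coeffs_mult (scal s) c) = coeffs_mult (scal (r * s)) c"
  by (cases c) (simp add: scal_def coeffs_mult_def)

lemma scal_1_mult: "coeffs_mult (scal 1) c = c"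
  by (cases c) (simp add: scal_def coeffs_mult_def)

text \<open>Inversion up to a scaling: the last entry of \<open>c'\<close> is normalised to 1, which
  puts \<open>c'\<close> on the positive side and leaves the sign of \<open>c\<close> in
  \<open>r\<close> and \<open>s\<close>.\<close>

lemma coeffs_inverse:
  assumes "c \<in> coeffs_space"
  obtains c' r s where "c' \<in> coeffs_space" "u_factor c' = 1" "coeffs_mult c' c = scal r" "coeffs_mult c c' = scal s"
proof -
  obtain \<alpha> \<beta> \<gamma> \<delta> l m \<sigma> where c: "c = (\<alpha>, \<beta>, \<gamma>, \<delta>, l, m, \<sigma>)" by (metis prod_cases7)
  have det: "\<alpha> * \<delta> - \<beta> * \<gamma> = 1" using assms by (simp add: coeffs_space_def c)
  \<comment> \<open>The inverse matrix, with shifts solving the two linear equations that make the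
    shifts of the product with \<open>c\<close> vanish.\<close>
  let ?c' = "(\<delta>, - \<beta>, - \<gamma>, \<alpha>, m * \<gamma> - l * \<delta>, l * \<beta> - m * \<alpha>, 1) :: coeffs"
  have 1: "\<alpha> * \<delta> = 1 + \<beta> * \<gamma>" using det by simp
  have "l + (m * \<gamma> - l * \<delta>) * \<alpha> + (l * \<beta> - m * \<alpha>) * \<gamma> = l - l * (\<alpha> * \<delta> - \<beta> * \<gamma>)"
    "m + (m * \<gamma> - l * \<delta>) * \<beta> + (l * \<beta> - m * \<alpha>) * \<delta> = m - m * (\<alpha> * \<delta> - \<beta> * \<gamma>)"
    by (simp_all add: algebra_simps)
  then have 2: "l + (m * \<gamma> - l * \<delta>) * \<alpha> + (l * \<beta> - m * \<alpha>) * \<gamma> = 0"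
    "m + (m * \<gamma> - l * \<delta>) * \<beta> + (l * \<beta> - m * \<alpha>) * \<delta> = 0" using det by simp_all
  have "?c' \<in> coeffs_space" "u_factor ?c' = 1"
    using det by (simp_all add: coeffs_space_def u_factor_def algebra_simps)
  moreover have "\<exists>r. coeffs_mult ?c' c = scal r"
    unfolding c coeffs_mult_def scal_def prod.case 2 using 1 by (simp add: mult.commute)
  moreover have "\<exists>s. coeffs_mult c ?c' = scal s"
    unfolding c coeffs_mult_def scal_def prod.case using 1 by (simp add: mult.commute)
  ultimately show ?thesis using that by blast
qed

definition zero_on :: "(real \<times> real) set \<Rightarrow> (real \<times> real \<rightharpoonup> real)" where
  "zero_on D = (\<lambda>z. if z \<in> D then Some 0 else None)"

lemma dom_zero_on: "dom (zero_on D) = D"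
  by (auto simp: zero_on_def split: if_splits)

lemma local_solution_zero_on: "open D \<Longrightarrow> D \<noteq> {} \<Longrightarrow> local_solution (zero_on D)"
  unfolding local_solution_iff dom_zero_on
  by (auto intro: heat_on_cong[OF heat_on_zero] simp: zero_on_def)

lemma local_solution_zero_UNIV: "local_solution (zero_on UNIV)"
  by (simp add: local_solution_zero_on)

lemma Some_eq_Phi: "Some = Phi (scal 1) (zero_on UNIV)"
  by (auto simp: fun_eq_iff Phi_eq dom_zero_on den_scal proj_scal amp_scal) (simp add: zero_on_def)

lemma sign_change_eq_Phi: "sign_change = Phi (scal (-1)) (zero_on UNIV)"
  by (auto simp: fun_eq_iff Phi_eq dom_zero_on den_scal proj_scal amp_scal sign_change_def)
    (simp add: zero_on_def)

text \<open>Unlike the coefficients, the parameter function is not unique: \<open>Phi\<close>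
  ignores its values on the singular line.\<close>

lemma Phi_cong_regular:
  assumes "\<And>t x. den c t \<noteq> 0 \<Longrightarrow> h (t, x) = h' (t, x)"
  shows "Phi c h = Phi c h'"
  using assms by (auto simp: fun_eq_iff Phi_eq domIff)

text \<open>Indexing by the real number \<open>sgn\<close> lets classes multiply like their indices;
  an index other than 1 and -1 gives the empty set.\<close>

definition sign_class :: "real \<Rightarrow> transformation set" where
  "sign_class e = {Phi c h | c h. c \<in> coeffs_space \<and> local_solution h \<and> sgn (u_factor c) = e}"

lemma sign_classI:
  "c \<in> coeffs_space \<Longrightarrow> local_solution h \<Longrightarrow> sgn (u_factor c) = e \<Longrightarrow> Phi c h \<in> sign_class e"
  unfolding sign_class_def by blast

lemma sign_classE:
  assumes "\<Phi> \<in> sign_class e"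
  obtains c h where "\<Phi> = Phi c h" "c \<in> coeffs_space" "local_solution h" "sgn (u_factor c) = e"
  using assms unfolding sign_class_def by blast

lemma u_factor_nonzero: "c \<in> coeffs_space \<Longrightarrow> u_factor c \<noteq> 0"
  by (auto simp: coeffs_space_def u_factor_def)

lemma heat_G_eq: "heat_G = sign_class 1 \<union> sign_class (-1)"
proof -
  have "sgn (u_factor c) = 1 \<or> sgn (u_factor c) = -1" if "c \<in> coeffs_space" for c
    using u_factor_nonzero[OF that] by (auto simp: sgn_if)
  then show ?thesis unfolding heat_G_def sign_class_def by blast
qed

lemma sign_class_unique: "\<Phi> \<in> sign_class e \<Longrightarrow> \<Phi> \<in> sign_class e' \<Longrightarrow> e = e'"
  using Phi_eq_imp_coeffs_eq by (metis sign_classE)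

text \<open>The converse of \<open>composable_imp_dom\<close>: a nonempty open domain does not fit
  into the singular line of the product.\<close>

lemma composable_Phi:
  assumes "c1 \<in> coeffs_space" "c2 \<in> coeffs_space" "local_solution h1" "local_solution h2"
    and "dom (comp_solution c2 h1 h2) \<noteq> {}"
  shows "composable (Phi c1 h1) (Phi c2 h2)"
proof -
  have "local_solution (comp_solution c2 h1 h2)" using local_solution_comp assms by blast
  then obtain t x where "(t, x) \<in> dom (comp_solution c2 h1 h2)" "den (coeffs_mult c1 c2) t \<noteq> 0"
    using regular_dom_nonempty coeffs_mult_in assms by metis
  then show ?thesis unfolding composable_def map_comp_Phi[OF assms(2)] dom_Phi by blast
qed

lemma mcomp_sign_class:
  assumes "\<Phi> \<in> sign_class a" "\<Psi> \<in> sign_class b" "composable \<Phi> \<Psi>"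
  shows "mcomp \<Phi> \<Psi> \<in> sign_class (a * b)"
proof -
  obtain c1 h1 where 1: "\<Phi> = Phi c1 h1" "c1 \<in> coeffs_space" "local_solution h1" "sgn (u_factor c1) = a"
    using assms(1) by (rule sign_classE)
  obtain c2 h2 where 2: "\<Psi> = Phi c2 h2" "c2 \<in> coeffs_space" "local_solution h2" "sgn (u_factor c2) = b"
    using assms(2) by (rule sign_classE)
  have "dom (comp_solution c2 h1 h2) \<noteq> {}" using composable_imp_dom 1 2 assms(3) by blast
  then obtain h where "local_solution h" "mcomp \<Phi> \<Psi> = Phi (coeffs_mult c1 c2) h"
    using mcomp_Phi[OF 1(2) 2(2) 1(3) 2(3)] 1(1) 2(1) by metis
  then show ?thesis using 1 2 by (auto intro!: sign_classI coeffs_mult_in simp: sgn_u_factor_mult)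
qed

text \<open>A scaling on the left keeps the singular line, so nothing is refilled, and
  \<open>h\<close> survives because it is changed only on that line.\<close>

lemma mcomp_scal_left:
  assumes "s \<noteq> 0" "c \<in> coeffs_space" "local_solution h"
  shows "composable (Phi (scal s) (zero_on UNIV)) (Phi c h)"
    and "mcomp (Phi (scal s) (zero_on UNIV)) (Phi c h) = Phi (coeffs_mult (scal s) c) h"
proof -
  obtain t x where tx: "(t, x) \<in> dom h" "den c t \<noteq> 0" using regular_dom_nonempty assms by blast
  then have dom: "dom (comp_solution c (zero_on UNIV) h) \<noteq> {}"
    unfolding dom_comp_solution dom_zero_on by force
  show "composable (Phi (scal s) (zero_on UNIV)) (Phi c h)"
    using composable_Phi assms dom by (simp add: scal_in local_solution_zero_UNIV)
  have "mcomp (Phi (scal s) (zero_on UNIV)) (Phi c h) = Phi (scal s) (zero_on UNIV) \<circ>\<^sub>m Phi c h"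
    using assms dom by (intro mcomp_Phi_eq_map_comp) (simp_all add: scal_in local_solution_zero_UNIV den_scal_mult)
  also have "\<dots> = Phi (coeffs_mult (scal s) c) h"
    unfolding map_comp_Phi[OF assms(2)]
  proof (rule Phi_cong_regular)
    fix t x assume "den (coeffs_mult (scal s) c) t \<noteq> 0"
    then show "comp_solution c (zero_on UNIV) h (t, x) = h (t, x)"
      by (cases "h (t, x)") (auto simp: den_scal_mult comp_solution_def dom_zero_on zero_on_def domIff)
  qed
  finally show "mcomp (Phi (scal s) (zero_on UNIV)) (Phi c h) = Phi (coeffs_mult (scal s) c) h" .
qed

lemma comp_solution_scal:
  "comp_solution (scal s) h1 h2 = (\<lambda>z. if z \<in> dom h1 \<inter> dom h2 then Some (the (h2 z) + the (h1 z) / s) else None)"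
  by (auto simp: comp_solution_def den_scal proj_scal amp_scal fun_eq_iff)

text \<open>A scaling as second factor has no singular line to refill.\<close>

lemma mcomp_scal_right:
  assumes "s \<noteq> 0" "c \<in> coeffs_space" "local_solution h1" "local_solution h2" "dom h1 \<inter> dom h2 \<noteq> {}"
  shows "composable (Phi c h1) (Phi (scal s) h2)"
    and "mcomp (Phi c h1) (Phi (scal s) h2) = Phi (coeffs_mult c (scal s)) (comp_solution (scal s) h1 h2)"
proof -
  have dom: "dom (comp_solution (scal s) h1 h2) \<noteq> {}"
    using assms(5) by (auto simp: dom_comp_solution den_scal proj_scal)
  show "composable (Phi c h1) (Phi (scal s) h2)"
    using composable_Phi assms dom by (simp add: scal_in)
  have "mcomp (Phi c h1) (Phi (scal s) h2) = Phi c h1 \<circ>\<^sub>m Phi (scal s) h2"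
    using assms dom by (intro mcomp_Phi_eq_map_comp) (simp_all add: scal_in den_scal)
  then show "mcomp (Phi c h1) (Phi (scal s) h2) = Phi (coeffs_mult c (scal s)) (comp_solution (scal s) h1 h2)"
    using assms(1) by (simp add: map_comp_Phi scal_in)
qed

section \<open>Paths of coefficients and of solutions\<close>

lemma path_componentI:
  fixes g :: "real \<Rightarrow> 'a :: topological_space"
  assumes "continuous_on {0..1} g" "\<And>r. r \<in> {0..1} \<Longrightarrow> g r \<in> S" "g 0 = x" "g 1 = y"
  shows "path_component S x y"
proof -
  have "path g" "path_image g \<subseteq> S" "pathstart g = x" "pathfinish g = y"
    using assms by (auto simp: path_def path_image_def pathstart_def pathfinish_def)
  then show ?thesis unfolding path_component_def by blast
qed

text \<open>After the shifts and \<sigma> are deformed linearly, the matrix is joined to the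
  identity by elementary row operations, each run as a path of determinant 1.\<close>

lemma path_component_coeffs:
  assumes c: "c \<in> coeffs_space" "u_factor c > 0"
  shows "path_component coeffs_space (scal 1) c"
proof -
  \<comment> \<open>With upper left entry 1, the entries \<beta> and \<gamma> shrink freely and the
    determinant dictates \<delta>.\<close>
  have unipotent: "path_component coeffs_space (1, \<beta>, \<gamma>, \<delta>, 0, 0, 1) (scal 1)" if "\<delta> - \<beta> * \<gamma> = 1" for \<beta> \<gamma> \<delta>
  proof (rule path_componentI[of "\<lambda>r. (1, (1 - r) * \<beta>, (1 - r) * \<gamma>, 1 + (1 - r) * \<beta> * ((1 - r) * \<gamma>), 0, 0, 1)"])
    show "(1, (1 - 0) * \<beta>, (1 - 0) * \<gamma>, 1 + (1 - 0) * \<beta> * ((1 - 0) * \<gamma>), 0, 0, 1) = (1, \<beta>, \<gamma>, \<delta>, 0, 0, 1::real)"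
      using that by simp
  qed (auto simp: coeffs_space_def scal_def intro!: continuous_intros)
  \<comment> \<open>A nonzero \<gamma> allows a multiple of the second row to turn \<alpha> into
    1.\<close>
  have lower: "path_component coeffs_space (\<alpha>, \<beta>, \<gamma>, \<delta>, 0, 0, 1) (scal 1)"
    if "\<alpha> * \<delta> - \<beta> * \<gamma> = 1" "\<gamma> \<noteq> 0" for \<alpha> \<beta> \<gamma> \<delta>
  proof -
    define s where "s = (1 - \<alpha>) / \<gamma>"
    have s: "\<alpha> + s * \<gamma> = 1" using that by (simp add: s_def)
    have det: "(\<alpha> + k * \<gamma>) * \<delta> - (\<beta> + k * \<delta>) * \<gamma> = 1" for k using that by (simp add: algebra_simps)
    have "path_component coeffs_space (\<alpha>, \<beta>, \<gamma>, \<delta>, 0, 0, 1) (1, \<beta> + s * \<delta>, \<gamma>, \<delta>, 0, 0, 1)"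
      by (rule path_componentI[of "\<lambda>r. (\<alpha> + r * s * \<gamma>, \<beta> + r * s * \<delta>, \<gamma>, \<delta>, 0, 0, 1)"])
        (use s det in \<open>auto simp: coeffs_space_def intro!: continuous_intros\<close>)
    moreover have "\<delta> - (\<beta> + s * \<delta>) * \<gamma> = 1" using det[of s] s by simp
    ultimately show ?thesis using unipotent path_component_trans by blast
  qed
  have special: "path_component coeffs_space (\<alpha>, \<beta>, \<gamma>, \<delta>, 0, 0, 1) (scal 1)"
    if det: "\<alpha> * \<delta> - \<beta> * \<gamma> = 1" for \<alpha> \<beta> \<gamma> \<delta>
  proof (cases "\<gamma> = 0")
    case True
    \<comment> \<open>Adding the first row to the second replaces \<gamma> = 0 by \<alpha>, which
      the determinant makes nonzero.\<close>
    have det': "\<alpha> * (\<delta> + k * \<beta>) - \<beta> * (\<gamma> + k * \<alpha>) = 1" for k using det by (simp add: algebra_simps)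
    have "path_component coeffs_space (\<alpha>, \<beta>, \<gamma>, \<delta>, 0, 0, 1) (\<alpha>, \<beta>, \<gamma> + 1 * \<alpha>, \<delta> + 1 * \<beta>, 0, 0, 1)"
      by (rule path_componentI[of "\<lambda>r. (\<alpha>, \<beta>, \<gamma> + r * \<alpha>, \<delta> + r * \<beta>, 0, 0, 1)"])
        (use det' in \<open>auto simp: coeffs_space_def intro!: continuous_intros\<close>)
    moreover have "\<gamma> + 1 * \<alpha> \<noteq> 0" using det True by auto
    ultimately show ?thesis using lower[OF det'[of 1]] path_component_trans by blast
  qed (use lower det in blast)
  obtain \<alpha> \<beta> \<gamma> \<delta> l m \<sigma> where c_eq: "c = (\<alpha>, \<beta>, \<gamma>, \<delta>, l, m, \<sigma>)" by (metis prod_cases7)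
  have det: "\<alpha> * \<delta> - \<beta> * \<gamma> = 1" and \<sigma>: "\<sigma> > 0" using c by (simp_all add: c_eq coeffs_space_def u_factor_def)
  have "(1 - r) * \<sigma> + r \<noteq> 0" if "r \<in> {0..1}" for r
  proof (cases "r = 1")
    case False
    then have "(1 - r) * \<sigma> > 0" using \<sigma> that by simp
    with that show ?thesis by (simp add: add_pos_nonneg order_less_imp_not_eq2)
  qed simp
  then have "path_component coeffs_space c (\<alpha>, \<beta>, \<gamma>, \<delta>, 0, 0, 1)"
    using det by (intro path_componentI[of "\<lambda>r. (\<alpha>, \<beta>, \<gamma>, \<delta>, (1 - r) * l, (1 - r) * m, (1 - r) * \<sigma> + r)"])
      (auto simp: coeffs_space_def c_eq intro!: continuous_intros)
  with special[OF det] show ?thesis using path_component_trans path_component_sym by blast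
qed

lemma u_factor_path_pos:
  assumes "path c" "path_image c \<subseteq> coeffs_space" "u_factor (pathstart c) > 0"
  shows "u_factor (pathfinish c) > 0"
proof (rule ccontr)
  assume neg: "\<not> u_factor (pathfinish c) > 0"
  have eq: "u_factor = (\<lambda>c. snd (snd (snd (snd (snd (snd c))))))" by (auto simp: u_factor_def)
  have cont: "continuous_on {0..1} (\<lambda>s. u_factor (c s))"
    using assms(1) unfolding path_def eq by (intro continuous_intros)
  have "\<exists>s\<ge>0. s \<le> 1 \<and> u_factor (c s) = 0"
    by (rule IVT2'[of "\<lambda>s. u_factor (c s)" 1 0 0])
      (use assms(3) neg cont in \<open>auto simp: pathstart_def pathfinish_def\<close>)
  then show False using assms(2) u_factor_nonzero by (fastforce simp: path_image_def)
qed

text \<open>Run backwards, the path scales \<open>h\<close> down to zero on \<open>dom h\<close> for \<open>s \<ge> 1/2\<close>. After that only the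
  domain of the zero solution changes: a ball of radius of order \<open>1/s\<close> is added to \<open>dom h\<close>.\<close>

lemma solution_path_from_zero:
  assumes "local_solution h"
  obtains H where "solution_path H" "H 0 = zero_on UNIV" "H 1 = h"
proof -
  let ?D = "dom h"
  have D: "open ?D" "?D \<noteq> {}" "heat_on (the \<circ> h) ?D" using assms by (auto simp: local_solution_iff heat_on_def)
  obtain p where "p \<in> ?D" using D(2) by blast
  then obtain e where e: "e > 0" "ball p e \<subseteq> ?D" using D(1) open_contains_ball by blast
  \<comment> \<open>The ball has radius e / (2 s): the whole plane at s = 0, and contained in
    \<open>ball p e\<close> as soon as s is at least 1/2.\<close>
  define W where "W s = ?D \<union> {z. s * dist p z < e / 2}" for s :: real
  \<comment> \<open>The factor vanishes for s up to 1/2, so the extension by zero is a solution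
    while the domain exceeds \<open>dom h\<close>.\<close>
  define k where "k s z = max 0 (2 * s - 1) * (if z \<in> ?D then the (h z) else 0)" for s z
  define H where "H s z = (if z \<in> W s then Some (k s z) else None)" for s z
  have dom: "dom (H s) = W s" for s by (auto simp: H_def split: if_splits)
  have W_late: "W s = ?D" if "s \<ge> 1 / 2" for s
  proof -
    have "z \<in> ?D" if "s * dist p z < e / 2" for z
    proof -
      have "1 / 2 * dist p z \<le> s * dist p z" using \<open>s \<ge> 1 / 2\<close> by (intro mult_right_mono) auto
      then have "z \<in> ball p e" using that by simp
      then show ?thesis using e(2) by blast
    qed
    then show ?thesis unfolding W_def by blast
  qed
  have open_W: "open (W s)" for s
    unfolding W_def using D(1) by (intro open_Un open_Collect_less continuous_intros)
  have "local_solution (H s)" for s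
  proof -
    have "heat_on (k s) (W s)"
    proof (cases "s \<ge> 1 / 2")
      case True
      show ?thesis unfolding W_late[OF True]
        by (rule heat_on_cong[OF heat_on_cmult[OF D(3), of "max 0 (2 * s - 1)"]]) (simp add: k_def)
    next
      case False
      then show ?thesis by (intro heat_on_cong[OF heat_on_zero[OF open_W]]) (simp add: k_def)
    qed
    then have "heat_on (the \<circ> H s) (W s)" by (rule heat_on_cong) (simp add: H_def)
    moreover have "W s \<noteq> {}" using D(2) by (auto simp: W_def)
    ultimately show ?thesis by (simp add: local_solution_iff dom[unfolded dom_def] dom)
  qed
  moreover have "openin (top_of_set ({0..1} \<times> UNIV)) (SIGMA s:{0..1}. dom (H s))"
  proof -
    have "open (UNIV \<times> ?D \<union> {(s, z). s * dist p z < e / 2})"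
      unfolding case_prod_beta using D(1) by (intro open_Un open_Times open_Collect_less continuous_intros) auto
    moreover have "(SIGMA s:{0..1}. dom (H s)) = ({0..1} \<times> UNIV) \<inter> (UNIV \<times> ?D \<union> {(s, z). s * dist p z < e / 2})"
      by (auto simp: dom W_def)
    ultimately show ?thesis by (auto simp: openin_open)
  qed
  moreover have "continuous_on (SIGMA s:{0..1}. dom (H s)) (\<lambda>(s, z). the (H s z))"
  proof -
    \<comment> \<open>Two open sets covering the domain of the path: on the first the values are 0,
      on the second they are a multiple of \<open>h\<close>.\<close>
    let ?A = "{w :: real \<times> real \<times> real. fst w < 1 / 2}" and ?B = "UNIV \<times> ?D :: (real \<times> real \<times> real) set"
    have "continuous_on ?A (\<lambda>w. k (fst w) (snd w))"
      by (rule continuous_on_eq[of _ "\<lambda>w. 0"]) (auto simp: k_def)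
    moreover have "continuous_on ?B (\<lambda>w. k (fst w) (snd w))"
    proof -
      have "continuous_on ?D (the \<circ> h)" using D(3) by (auto simp: heat_on_def dest: spec[of _ 0])
      then have "continuous_on ?B (\<lambda>w. (the \<circ> h) (snd w))"
        by (rule continuous_on_compose2) (auto intro: continuous_intros)
      then have "continuous_on ?B (\<lambda>w. max 0 (2 * fst w - 1) * (the \<circ> h) (snd w))"
        by (intro continuous_intros)
      then show ?thesis by (rule continuous_on_eq) (auto simp: k_def)
    qed
    moreover have "open ?A" "open ?B" using D(1) by (auto intro!: open_Collect_less open_Times continuous_intros)
    ultimately have "continuous_on (?A \<union> ?B) (\<lambda>w. k (fst w) (snd w))"
      by (intro continuous_on_open_Un)
    moreover have "(SIGMA s:{0..1}. dom (H s)) \<subseteq> ?A \<union> ?B"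
      by (auto simp: dom W_late not_less)
    ultimately have "continuous_on (SIGMA s:{0..1}. dom (H s)) (\<lambda>w. k (fst w) (snd w))"
      using continuous_on_subset by blast
    then show ?thesis by (rule continuous_on_eq) (auto simp: H_def dom)
  qed
  ultimately have "solution_path H" by (simp add: solution_path_def)
  moreover have "H 0 = zero_on UNIV" using e(1) by (auto simp: H_def W_def k_def zero_on_def fun_eq_iff)
  moreover have "H 1 = h" by (auto simp: H_def W_late k_def fun_eq_iff domIff)
  ultimately show ?thesis using that by blast
qed

lemma heat_G_id_eq: "heat_G_id = sign_class 1"
proof (intro equalityI subsetI)
  fix \<Phi> assume "\<Phi> \<in> heat_G_id"
  then obtain c H where 1: "path c" "path_image c \<subseteq> coeffs_space" "solution_path H"
    "Phi (pathstart c) (H 0) = Some" "Phi (pathfinish c) (H 1) = \<Phi>"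
    unfolding heat_G_id_def by blast
  have c: "pathstart c \<in> coeffs_space" "pathfinish c \<in> coeffs_space" using 1(2) by auto
  have H: "local_solution (H 0)" "local_solution (H 1)" using 1(3) by (auto simp: solution_path_def)
  have "pathstart c = scal 1"
    using Phi_eq_imp_coeffs_eq[OF c(1) _ H(1)] 1(4) Some_eq_Phi scal_in by (metis zero_neq_one)
  then have "u_factor (pathfinish c) > 0" using u_factor_path_pos[OF 1(1,2)] by (simp add: u_factor_scal)
  then show "\<Phi> \<in> sign_class 1" using 1(5) c H sign_classI by (metis sgn_pos)
next
  fix \<Phi> assume "\<Phi> \<in> sign_class 1"
  then obtain c h where 1: "\<Phi> = Phi c h" "c \<in> coeffs_space" "local_solution h" "sgn (u_factor c) = 1"
    by (rule sign_classE)
  obtain H where H: "solution_path H" "H 0 = zero_on UNIV" "H 1 = h"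
    using solution_path_from_zero[OF 1(3)] .
  have "u_factor c > 0" using 1(4) by (simp add: sgn_1_pos)
  then obtain g where "path g" "path_image g \<subseteq> coeffs_space" "pathstart g = scal 1" "pathfinish g = c"
    using path_component_coeffs[OF 1(2)] unfolding path_component_def by blast
  then show "\<Phi> \<in> heat_G_id" using H 1(1) Some_eq_Phi unfolding heat_G_id_def by fastforce
qed

section \<open>The cosets of the identity component\<close>

abbreviation sign_rep :: "real \<Rightarrow> transformation" where
  "sign_rep e \<equiv> Phi (scal e) (zero_on UNIV)"

lemma zero_on_in_sign_class:
  "s \<noteq> 0 \<Longrightarrow> open D \<Longrightarrow> D \<noteq> {} \<Longrightarrow> sgn s = e \<Longrightarrow> Phi (scal s) (zero_on D) \<in> sign_class e"
  by (intro sign_classI) (simp_all add: scal_in local_solution_zero_on u_factor_scal)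

lemma local_solution_cmult: "local_solution h \<Longrightarrow> local_solution (\<lambda>z. map_option (\<lambda>u. k * u) (h z))"
proof -
  assume h: "local_solution h"
  have dom: "dom (\<lambda>z. map_option (\<lambda>u. k * u) (h z)) = dom h" by (auto simp: dom_def)
  have "heat_on (the \<circ> h) (dom h)" using h by (simp only: local_solution_iff)
  then have "heat_on (\<lambda>z. k * (the \<circ> h) z) (dom h)" by (rule heat_on_cmult)
  then have "heat_on (the \<circ> (\<lambda>z. map_option (\<lambda>u. k * u) (h z))) (dom h)" 
    by (rule heat_on_cong) auto
  then show ?thesis using h unfolding local_solution_iff dom by blast
qed

lemma equivclp_left_rep:
  fixes R :: "transformation \<Rightarrow> transformation \<Rightarrow> bool"
  assumes R: "\<And>\<Theta> \<Phi>. \<Phi> \<in> heat_G \<Longrightarrow> \<Theta> \<in> heat_G_id \<Longrightarrow> composable \<Theta> \<Phi> \<Longrightarrow> R \<Phi> (mcomp \<Theta> \<Phi>)"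
    and \<Phi>: "\<Phi> \<in> sign_class e"
  shows "equivclp R \<Phi> (sign_rep e)"
proof -
  obtain c h where 1: "\<Phi> = Phi c h" "c \<in> coeffs_space" "local_solution h" "sgn (u_factor c) = e"
    using \<Phi> by (rule sign_classE)
  have e: "e \<noteq> 0" using u_factor_nonzero[OF 1(2)] 1(4) by (metis sgn_0_0)
  obtain c' r where c': "c' \<in> coeffs_space" "u_factor c' = 1" "coeffs_mult c' c = scal r"
    using coeffs_inverse[OF 1(2)] by metis
  have sgn_r: "sgn r = e" using sgn_u_factor_mult[of c' c] 1 c' by (simp add: u_factor_scal)
  then have r: "r \<noteq> 0" "1 / \<bar>r\<bar> * r = e" using e by (auto simp: sgn_if)
  define \<Theta>1 where "\<Theta>1 = Phi c' (zero_on UNIV)"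
  have \<Theta>1: "\<Theta>1 \<in> heat_G_id" unfolding heat_G_id_eq \<Theta>1_def
    using c' by (intro sign_classI) (simp_all add: local_solution_zero_UNIV)
  obtain t x where "(t, x) \<in> dom h" "den c t \<noteq> 0" using regular_dom_nonempty 1 by blast
  then have dom: "dom (comp_solution c (zero_on UNIV) h) \<noteq> {}"
    unfolding dom_comp_solution dom_zero_on by force
  have "composable \<Theta>1 \<Phi>"
    unfolding \<Theta>1_def 1 using composable_Phi c' 1 dom local_solution_zero_UNIV by blast
  moreover obtain h' where h': "local_solution h'" "mcomp \<Theta>1 \<Phi> = Phi (scal r) h'"
    unfolding \<Theta>1_def 1 using mcomp_Phi[OF c'(1) 1(2) local_solution_zero_UNIV 1(3) dom] c'(3) by metis
  ultimately have step1: "R \<Phi> (Phi (scal r) h')"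
    using R[OF _ \<Theta>1, of \<Phi>] 1 by (simp add: heat_GI)
  \<comment> \<open>Chosen so that h' + g / r = 0; the scaling by the inverse of
    \<open>\<bar>r\<bar>\<close> normalises \<open>r\<close> to its sign.\<close>
  let ?g = "\<lambda>z. map_option (\<lambda>u. - r * u) (h' z)"
  have dom_g: "dom ?g = dom h'" by (auto simp: dom_def)
  have D: "open (dom h')" "dom h' \<noteq> {}" using h' by (auto simp: local_solution_def)
  have g: "local_solution ?g" using local_solution_cmult h' by blast
  have \<Theta>2: "Phi (scal (1 / \<bar>r\<bar>)) ?g \<in> heat_G_id"
    unfolding heat_G_id_eq using r g by (intro sign_classI) (simp_all add: scal_in u_factor_scal)
  have "comp_solution (scal r) ?g h' = zero_on (dom h')"
    using r by (auto simp: comp_solution_scal dom_g zero_on_def fun_eq_iff)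
  moreover have "coeffs_mult (scal (1 / \<bar>r\<bar>)) (scal r) = scal e"
    by (simp only: scal_mult_scal r)
  moreover have "scal (1 / \<bar>r\<bar>) \<in> coeffs_space" "dom ?g \<inter> dom h' \<noteq> {}" using r D dom_g by (auto simp: scal_in)
  ultimately have "composable (Phi (scal (1 / \<bar>r\<bar>)) ?g) (Phi (scal r) h')"
    "mcomp (Phi (scal (1 / \<bar>r\<bar>)) ?g) (Phi (scal r) h') = Phi (scal e) (zero_on (dom h'))"
    using mcomp_scal_right[OF r(1) _ g h'(1)] by metis+
  then have step2: "R (Phi (scal r) h') (Phi (scal e) (zero_on (dom h')))"
    using R[OF _ \<Theta>2, of "Phi (scal r) h'"] h' r by (simp add: heat_GI scal_in)
  \<comment> \<open>The identity restricted to \<open>dom h'\<close>. It cuts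
    \<open>sign_rep e\<close> down to the element just reached, so this last link is traversed
    backwards, which the equivalence closure permits.\<close>
  have \<Theta>3: "Phi (scal 1) (zero_on (dom h')) \<in> heat_G_id"
    unfolding heat_G_id_eq using D by (intro zero_on_in_sign_class) auto
  have "comp_solution (scal e) (zero_on (dom h')) (zero_on UNIV) = zero_on (dom h')"
    unfolding comp_solution_scal dom_zero_on by (auto simp: zero_on_def fun_eq_iff)
  moreover have "coeffs_mult (scal 1) (scal e) = scal e" by (simp add: scal_mult_scal)
  moreover have "scal 1 \<in> coeffs_space" "dom (zero_on (dom h')) \<inter> dom (zero_on UNIV) \<noteq> {}"
    using D unfolding dom_zero_on by (auto simp: scal_in)
  ultimately have "composable (Phi (scal 1) (zero_on (dom h'))) (sign_rep e)"
    "mcomp (Phi (scal 1) (zero_on (dom h'))) (sign_rep e) = Phi (scal e) (zero_on (dom h'))"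
    using mcomp_scal_right[OF e _ local_solution_zero_on[OF D] local_solution_zero_UNIV] by metis+
  then have step3: "R (sign_rep e) (Phi (scal e) (zero_on (dom h')))"
    using R[OF _ \<Theta>3, of "sign_rep e"] e by (simp add: heat_GI scal_in local_solution_zero_UNIV)
  show ?thesis
    using step1 step2 step3 by (meson r_into_equivclp equivclp_sym equivclp_trans)
qed

lemma equivclp_right_rep:
  fixes R :: "transformation \<Rightarrow> transformation \<Rightarrow> bool"
  assumes R: "\<And>\<Theta> \<Phi>. \<Phi> \<in> heat_G \<Longrightarrow> \<Theta> \<in> heat_G_id \<Longrightarrow> composable \<Phi> \<Theta> \<Longrightarrow> R \<Phi> (mcomp \<Phi> \<Theta>)"
    and \<Phi>: "\<Phi> \<in> sign_class e"
  shows "equivclp R \<Phi> (sign_rep e)"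
proof -
  obtain c h where 1: "\<Phi> = Phi c h" "c \<in> coeffs_space" "local_solution h" "sgn (u_factor c) = e"
    using \<Phi> by (rule sign_classE)
  have e: "e \<noteq> 0" using u_factor_nonzero[OF 1(2)] 1(4) by (metis sgn_0_0)
  obtain c' r s where c': "c' \<in> coeffs_space" "u_factor c' = 1" "coeffs_mult c' c = scal s" "coeffs_mult c c' = scal r"
    using coeffs_inverse[OF 1(2)] by metis
  have sgn_r: "sgn r = e" using sgn_u_factor_mult[of c c'] 1 c' by (simp add: u_factor_scal)
  then have r: "r \<noteq> 0" "r * (1 / \<bar>r\<bar>) = e" using e by (auto simp: sgn_if)
  define \<Theta>1 where "\<Theta>1 = Phi c' (zero_on UNIV)"
  have \<Theta>1: "\<Theta>1 \<in> heat_G_id" unfolding heat_G_id_eq \<Theta>1_def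
    using c' by (intro sign_classI) (simp_all add: local_solution_zero_UNIV)
  obtain t x where tx: "(t, x) \<in> dom h" "den c t \<noteq> 0" using regular_dom_nonempty 1 by blast
  \<comment> \<open>The inverse coefficients now act first, so a common point of the domains is the
    image under \<open>proj c\<close> of a regular point of \<open>h\<close>.\<close>
  have "den c' (fst (proj c (t, x))) \<noteq> 0" "proj c' (proj c (t, x)) = (t, x)"
    using den_mult[of c "(t, x)" c'] proj_mult[of c "(t, x)" c'] tx by (auto simp: c' den_scal proj_scal)
  then have "proj c (t, x) \<in> dom (comp_solution c' h (zero_on UNIV))"
    using tx(1) unfolding dom_comp_solution dom_zero_on by simp
  then have dom: "dom (comp_solution c' h (zero_on UNIV)) \<noteq> {}" by blast
  have "composable \<Phi> \<Theta>1"
    unfolding \<Theta>1_def 1 using composable_Phi c' 1 dom local_solution_zero_UNIV by blast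
  moreover obtain h' where h': "local_solution h'" "mcomp \<Phi> \<Theta>1 = Phi (scal r) h'"
    unfolding \<Theta>1_def 1 using mcomp_Phi[OF 1(2) c'(1) 1(3) local_solution_zero_UNIV dom] c'(4) by metis
  ultimately have step1: "R \<Phi> (Phi (scal r) h')"
    using R[OF _ \<Theta>1, of \<Phi>] 1 by (simp add: heat_GI)
  \<comment> \<open>The scaling is now the second factor, so \<open>h'\<close> is divided by the
    inverse of \<open>\<bar>r\<bar>\<close> and must be cancelled by \<open>\<bar>r\<bar>\<close>
    times itself.\<close>
  let ?g = "\<lambda>z. map_option (\<lambda>u. - \<bar>r\<bar> * u) (h' z)"
  have dom_g: "dom ?g = dom h'" by (auto simp: dom_def)
  have D: "open (dom h')" "dom h' \<noteq> {}" using h' by (auto simp: local_solution_def)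
  have g: "local_solution ?g" using local_solution_cmult h' by blast
  have r': "1 / \<bar>r\<bar> \<noteq> 0" using r by simp
  have \<Theta>2: "Phi (scal (1 / \<bar>r\<bar>)) ?g \<in> heat_G_id"
    unfolding heat_G_id_eq using r g by (intro sign_classI) (simp_all add: scal_in u_factor_scal)
  have "comp_solution (scal (1 / \<bar>r\<bar>)) h' ?g = zero_on (dom h')"
    unfolding comp_solution_scal dom_g using r by (auto simp: zero_on_def fun_eq_iff)
  moreover have "coeffs_mult (scal r) (scal (1 / \<bar>r\<bar>)) = scal e"
    by (simp only: scal_mult_scal r)
  moreover have "scal r \<in> coeffs_space" "dom h' \<inter> dom ?g \<noteq> {}" using r D dom_g by (auto simp: scal_in)
  ultimately have "composable (Phi (scal r) h') (Phi (scal (1 / \<bar>r\<bar>)) ?g)"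
    "mcomp (Phi (scal r) h') (Phi (scal (1 / \<bar>r\<bar>)) ?g) = Phi (scal e) (zero_on (dom h'))"
    using mcomp_scal_right[OF r' _ h'(1) g] by metis+
  then have step2: "R (Phi (scal r) h') (Phi (scal e) (zero_on (dom h')))"
    using R[OF _ \<Theta>2, of "Phi (scal r) h'"] h' r by (simp add: heat_GI scal_in)
  have \<Theta>3: "Phi (scal 1) (zero_on (dom h')) \<in> heat_G_id"
    unfolding heat_G_id_eq using D by (intro zero_on_in_sign_class) auto
  have "comp_solution (scal 1) (zero_on UNIV) (zero_on (dom h')) = zero_on (dom h')"
    unfolding comp_solution_scal dom_zero_on by (auto simp: zero_on_def fun_eq_iff)
  moreover have "coeffs_mult (scal e) (scal 1) = scal e" by (simp add: scal_mult_scal)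
  moreover have "scal e \<in> coeffs_space" "dom (zero_on UNIV) \<inter> dom (zero_on (dom h')) \<noteq> {}"
    using D e unfolding dom_zero_on by (auto simp: scal_in)
  ultimately have "composable (sign_rep e) (Phi (scal 1) (zero_on (dom h')))"
    "mcomp (sign_rep e) (Phi (scal 1) (zero_on (dom h'))) = Phi (scal e) (zero_on (dom h'))"
    using mcomp_scal_right[OF one_neq_zero _ local_solution_zero_UNIV local_solution_zero_on[OF D]] by metis+
  then have step3: "R (sign_rep e) (Phi (scal e) (zero_on (dom h')))"
    using R[OF _ \<Theta>3, of "sign_rep e"] e by (simp add: heat_GI scal_in local_solution_zero_UNIV)
  show ?thesis
    using step1 step2 step3 by (meson r_into_equivclp equivclp_sym equivclp_trans)
qed

text \<open>The equality disjunct reflects that \<open>equivclp\<close> is reflexive on all partial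
  maps, also outside \<open>heat_G\<close>.\<close>

definition same_sign :: "transformation rel" where
  "same_sign = {(\<Phi>, \<Psi>). \<Phi> = \<Psi> \<or> (\<exists>e. \<Phi> \<in> sign_class e \<and> \<Psi> \<in> sign_class e)}"

text \<open>Shared by both congruences: steps preserve the sign, and a common representative links
  any two elements of one class.\<close>

lemma equivclp_eq_same_sign:
  assumes sound: "\<And>\<Phi> \<Psi>. R \<Phi> \<Psi> \<Longrightarrow> \<exists>e. \<Phi> \<in> sign_class e \<and> \<Psi> \<in> sign_class e"
    and rep: "\<And>\<Phi> e. \<Phi> \<in> sign_class e \<Longrightarrow> equivclp R \<Phi> (sign_rep e)"
  shows "{(\<Phi>, \<Psi>). equivclp R \<Phi> \<Psi>} = same_sign"
proof -
  have "(\<Phi>, \<Psi>) \<in> same_sign" if "equivclp R \<Phi> \<Psi>" for \<Phi> \<Psi>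
    using that
  proof (induction rule: equivclp_induct)
    case (step \<Psi> \<Psi>')
    obtain e where "\<Psi> \<in> sign_class e" "\<Psi>' \<in> sign_class e" using step.hyps(2) sound by blast
    with step.IH show ?case unfolding same_sign_def using sign_class_unique by blast
  qed (simp add: same_sign_def)
  moreover have "equivclp R \<Phi> \<Psi>" if "(\<Phi>, \<Psi>) \<in> same_sign" for \<Phi> \<Psi>
  proof (cases "\<Phi> = \<Psi>")
    case False
    then obtain e where "\<Phi> \<in> sign_class e" "\<Psi> \<in> sign_class e" using \<open>(\<Phi>, \<Psi>) \<in> same_sign\<close>
      by (auto simp: same_sign_def)
    then show ?thesis using equivclp_trans[OF rep equivclp_sym[OF rep]] by blast
  qed simp
  ultimately show ?thesis by auto
qed

lemma left_congruence_eq: "left_congruence heat_G_id = same_sign"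
  unfolding left_congruence_def
proof (rule equivclp_eq_same_sign)
  fix \<Phi> \<Psi> assume "\<Phi> \<in> heat_G \<and> (\<exists>\<Theta>\<in>heat_G_id. composable \<Theta> \<Phi> \<and> \<Psi> = mcomp \<Theta> \<Phi>)"
  then show "\<exists>e. \<Phi> \<in> sign_class e \<and> \<Psi> \<in> sign_class e"
    using mcomp_sign_class[of _ 1 \<Phi>] unfolding heat_G_id_eq heat_G_eq by auto
qed (rule equivclp_left_rep; blast)

lemma right_congruence_eq: "right_congruence heat_G_id = same_sign"
  unfolding right_congruence_def
proof (rule equivclp_eq_same_sign)
  fix \<Phi> \<Psi> assume "\<Phi> \<in> heat_G \<and> (\<exists>\<Theta>\<in>heat_G_id. composable \<Phi> \<Theta> \<and> \<Psi> = mcomp \<Phi> \<Theta>)"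
  then show "\<exists>e. \<Phi> \<in> sign_class e \<and> \<Psi> \<in> sign_class e"
    using mcomp_sign_class[of \<Phi> _ _ 1] unfolding heat_G_id_eq heat_G_eq by (metis Un_iff mult_1_right)
qed (rule equivclp_right_rep; blast)

lemma sign_rep_in: "e = 1 \<or> e = -1 \<Longrightarrow> sign_rep e \<in> sign_class e"
  by (intro zero_on_in_sign_class) auto

section \<open>The factor group and the list of discrete symmetries\<close>

lemma quotient_eq: "heat_G // same_sign = {sign_class 1, sign_class (-1)}"
proof -
  have "same_sign `` {\<Phi>} = sign_class e" if "\<Phi> \<in> sign_class e" for \<Phi> e
    using that sign_class_unique unfolding same_sign_def by blast
  then show ?thesis
    using sign_rep_in[of 1] sign_rep_in[of "-1"] unfolding quotient_def heat_G_eq by blast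
qed

text \<open>\<open>sign_rep e\<close> is an involution for e = 1 and e = -1, so the other factor is
  the product of \<open>sign_rep e\<close> with the given element.\<close>

lemma sign_class_factor:
  assumes e: "e = 1 \<or> e = -1" and \<Phi>: "\<Phi> \<in> sign_class f"
  shows "\<exists>\<Psi>\<in>sign_class (e * f). composable (sign_rep e) \<Psi> \<and> \<Phi> = mcomp (sign_rep e) \<Psi>"
proof -
  obtain c h where 1: "\<Phi> = Phi c h" "c \<in> coeffs_space" "local_solution h" "sgn (u_factor c) = f"
    using \<Phi> by (rule sign_classE)
  have e0: "e \<noteq> 0" "e * e = 1" "sgn e = e" using e by auto
  have c': "coeffs_mult (scal e) c \<in> coeffs_space" using coeffs_mult_in scal_in 1 e0 by blast
  have "Phi (coeffs_mult (scal e) c) h \<in> sign_class (e * f)"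
    using c' 1 e0 by (intro sign_classI) (simp_all add: sgn_u_factor_mult u_factor_scal)
  moreover have "\<Phi> = mcomp (sign_rep e) (Phi (coeffs_mult (scal e) c) h)"
    using mcomp_scal_left(2)[OF e0(1) c' 1(3)] by (simp add: scal_mult_scal_mult e0 scal_1_mult 1)
  ultimately show ?thesis using mcomp_scal_left(1)[OF e0(1) c' 1(3)] by blast
qed

text \<open>The elementwise products fill the whole class because \<open>sign_rep a\<close> alone,
  as left factor, already reaches every element.\<close>

lemma sign_class_mult:
  assumes a: "a = 1 \<or> a = -1"
  shows "{mcomp \<Phi> \<Psi> | \<Phi> \<Psi>. \<Phi> \<in> sign_class a \<and> \<Psi> \<in> sign_class b \<and> composable \<Phi> \<Psi>} = sign_class (a * b)"
proof (intro equalityI subsetI)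
  fix X assume "X \<in> sign_class (a * b)"
  moreover have "a * (a * b) = b" using a by auto
  ultimately show "X \<in> {mcomp \<Phi> \<Psi> | \<Phi> \<Psi>. \<Phi> \<in> sign_class a \<and> \<Psi> \<in> sign_class b \<and> composable \<Phi> \<Psi>}"
    using sign_class_factor[OF a, of X "a * b"] sign_rep_in[OF a] by (fastforce simp only:)
qed (auto intro: mcomp_sign_class)

lemma composites_heat_G_id: "\<Phi> \<in> composites heat_G_id \<Longrightarrow> \<Phi> \<in> sign_class 1"
  by (induction rule: composites.induct) (use mcomp_sign_class[of _ 1 _ 1] in \<open>auto simp: heat_G_id_eq\<close>)

lemma heat_factor_eq:
  "carrier (heat_factor heat_G_id) = {sign_class 1, sign_class (-1)}"
  "a = 1 \<or> a = -1 \<Longrightarrow> sign_class a \<otimes>\<^bsub>heat_factor heat_G_id\<^esub> sign_class b = sign_class (a * b)"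
  "\<one>\<^bsub>heat_factor heat_G_id\<^esub> = sign_class 1"
proof -
  show "carrier (heat_factor heat_G_id) = {sign_class 1, sign_class (-1)}"
    unfolding heat_factor_def by (simp only: partial_object.simps left_congruence_eq quotient_eq)
qed (simp_all add: heat_factor_def sign_class_mult heat_G_id_eq)

lemma group_heat_factor: "group (heat_factor heat_G_id)"
  by (rule groupI) (auto simp: heat_factor_eq)

lemma sign_class_neq: "sign_class 1 \<noteq> sign_class (-1)"
  using sign_rep_in[of 1] sign_class_unique[of "sign_rep 1" 1 "-1"] by auto

lemma heat_factor_iso: "heat_factor heat_G_id \<cong> integer_mod_group 2"
proof -
  define f :: "transformation set \<Rightarrow> int" where "f A = (if A = sign_class 1 then 0 else 1)" for A
  have f: "f (sign_class 1) = 0" "f (sign_class (-1)) = 1" using sign_class_neq by (auto simp: f_def)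
  have "f \<in> iso (heat_factor heat_G_id) (integer_mod_group 2)"
  proof (rule isoI)
    show "f \<in> hom (heat_factor heat_G_id) (integer_mod_group 2)"
      by (rule homI) (auto simp: heat_factor_eq f integer_mod_group_def)
    show "bij_betw f (carrier (heat_factor heat_G_id)) (carrier (integer_mod_group 2))"
      by (auto simp: bij_betw_def heat_factor_eq f integer_mod_group_def)
  qed
  then show ?thesis by (auto simp: is_iso_def)
qed

theorem corollary4:
  shows "complete_discrete_list {sign_change} \<and> independent_discrete_list {sign_change} \<and>
         mcomp sign_change sign_change = Some \<and>
         left_congruence heat_G_id = right_congruence heat_G_id \<and>
         group (heat_factor heat_G_id) \<and>
         heat_factor heat_G_id \<cong> integer_mod_group 2"
proof (intro conjI)
  have discrete: "heat_G - heat_G_id = sign_class (-1)"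
    using sign_class_unique[of _ 1 "-1"] unfolding heat_G_eq heat_G_id_eq by auto
  have sc: "sign_change \<in> sign_class (-1)" using sign_rep_in by (simp add: sign_change_eq_Phi)
  show "complete_discrete_list {sign_change}"
    unfolding complete_discrete_list_def discrete
  proof (intro conjI subsetI)
    fix \<Phi> assume "\<Phi> \<in> sign_class (-1)"
    then obtain \<Psi> where "\<Psi> \<in> sign_class 1" "composable sign_change \<Psi>" "\<Phi> = mcomp sign_change \<Psi>"
      using sign_class_factor[of "-1" \<Phi> "-1"] by (auto simp: sign_change_eq_Phi)
    then show "\<Phi> \<in> composites ({sign_change} \<union> heat_G_id)"
      by (auto simp: heat_G_id_eq intro: composites.intros)
  qed (use sc in auto)
  \<comment> \<open>Without its only member the list leaves composites of continuous symmetries, all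
    of positive sign.\<close>
  show "independent_discrete_list {sign_change}"
    unfolding independent_discrete_list_def discrete
    using sc composites_heat_G_id sign_class_unique[of sign_change 1 "-1"] by auto
  show "mcomp sign_change sign_change = Some"
    unfolding sign_change_eq_Phi Some_eq_Phi
    by (subst mcomp_scal_left) (simp_all add: scal_in scal_mult_scal local_solution_zero_UNIV)
  show "left_congruence heat_G_id = right_congruence heat_G_id"
    by (simp add: left_congruence_eq right_congruence_eq)
qed (rule group_heat_factor heat_factor_iso)+

end
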